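(* Let $\mathbb{X}$ be a Banach space with the Radon-Nikodym Property and let $\mathbb{Y}$ be any Banach space. The set of norm attaining operators satisfying the Bhatia-Šemrl (BŠ) Property is dense in $\mathbb{L}(\mathbb{X},\mathbb{Y})$.
   Context: Banach spaces are over $\mathbb{R}$ or $\mathbb{C}$ (the same field for $\mathbb{X}$ and $\mathbb{Y}$). $\mathbb{L}(\mathbb{X},\mathbb{Y})$ is the space of bounded linear operators with the operator norm. For $T\in\mathbb{L}(\mathbb{X},\mathbb{Y})$, $M_T=\{x\in S_{\mathbb{X}}: \|Tx\|=\|T\|\}$, where $S_{\mathbb{X}}$ is the unit sphere; $T$ is norm attaining if $M_T\ne\emptyset$. For $u,v$ in a Banach space, $u\perp_B v$ (Birkhoff-James orthogonality) means $\|u+\lambda v\|\ge\|u\|$ for every scalar $\lambda$. An operator $T\in\mathbb{L}(\mathbb{X},\mathbb{Y})$ satisfies the Bhatia-Šemrl (BŠ) Property if for any $A\in\mathbb{L}(\mathbb{X},\mathbb{Y})$: $T\perp_B A$ if and only if $Tx\perp_B Ax$ for some $x\in M_T$. *)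

theory Defs
  imports "HOL-Analysis.Analysis"
begin

text \<open>
  The library's Banach spaces are real.  To treat both scalar fields uniformly, the scalar field is
  a type isometrically isomorphic to the reals or to the complex numbers, and a Banach space over
  it is a real Banach space together with a compatible scalar multiplication.
\<close>

class real_or_complex = real_normed_field +
  assumes real_or_complex:
    "\<exists>f :: 'a \<Rightarrow> complex.
       (\<forall>x y. f (x + y) = f x + f y) \<and> (\<forall>x y. f (x * y) = f x * f y) \<and>
       (\<forall>r x. f (r *\<^sub>R x) = r *\<^sub>R f x) \<and> (\<forall>x. cmod (f x) = norm x) \<and>
       (range f = \<real> \<or> range f = UNIV)"

instance real :: real_or_complex
proof
  show "\<exists>f :: real \<Rightarrow> complex.
       (\<forall>x y. f (x + y) = f x + f y) \<and> (\<forall>x y. f (x * y) = f x * f y) \<and>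
       (\<forall>r x. f (r *\<^sub>R x) = r *\<^sub>R f x) \<and> (\<forall>x. cmod (f x) = norm x) \<and>
       (range f = \<real> \<or> range f = UNIV)"
    by (rule exI[of _ complex_of_real]) (auto simp: Reals_def scaleR_conv_of_real)
qed

instance complex :: real_or_complex
proof
  show "\<exists>f :: complex \<Rightarrow> complex.
       (\<forall>x y. f (x + y) = f x + f y) \<and> (\<forall>x y. f (x * y) = f x * f y) \<and>
       (\<forall>r x. f (r *\<^sub>R x) = r *\<^sub>R f x) \<and> (\<forall>x. cmod (f x) = norm x) \<and>
       (range f = \<real> \<or> range f = UNIV)"
    by (rule exI[of _ "\<lambda>z. z"]) auto
qed

locale banach_over = vector_space scale
  for scale :: "'k::real_or_complex \<Rightarrow> 'x::banach \<Rightarrow> 'x" +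
  assumes scale_of_real: "scale (of_real r) x = r *\<^sub>R x"
    and norm_scale: "norm (scale c x) = norm c * norm x"

lemma banach_over_scaleR: "banach_over (scaleR :: real \<Rightarrow> 'x::banach \<Rightarrow> 'x)"
  by unfold_locales (auto simp: algebra_simps)

lemma banach_over_complex: "banach_over ((*) :: complex \<Rightarrow> complex \<Rightarrow> complex)"
  by unfold_locales (auto simp: algebra_simps norm_mult scaleR_conv_of_real)

definition bounded_ops ::
    "('k \<Rightarrow> 'x \<Rightarrow> 'x) \<Rightarrow> ('k \<Rightarrow> 'y \<Rightarrow> 'y) \<Rightarrow> ('x::banach \<Rightarrow>\<^sub>L 'y::banach) set" where
  "bounded_ops sX sY = {T. \<forall>c x. blinfun_apply T (sX c x) = sY c (blinfun_apply T x)}"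

definition op_scale ::
    "('k \<Rightarrow> 'y \<Rightarrow> 'y) \<Rightarrow> 'k \<Rightarrow> ('x::banach \<Rightarrow>\<^sub>L 'y::banach) \<Rightarrow> ('x \<Rightarrow>\<^sub>L 'y)" where
  "op_scale sY c T = Blinfun (\<lambda>x. sY c (blinfun_apply T x))"

definition bj_orthogonal :: "('k \<Rightarrow> 'v \<Rightarrow> 'v) \<Rightarrow> 'v::real_normed_vector \<Rightarrow> 'v \<Rightarrow> bool" where
  "bj_orthogonal s u v \<longleftrightarrow> (\<forall>c. norm (u + s c v) \<ge> norm u)"

definition norm_attainment_set :: "('x::banach \<Rightarrow>\<^sub>L 'y::banach) \<Rightarrow> 'x set" where
  "norm_attainment_set T = {x \<in> sphere 0 1. norm (blinfun_apply T x) = norm T}"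

definition norm_attaining :: "('x::banach \<Rightarrow>\<^sub>L 'y::banach) \<Rightarrow> bool" where
  "norm_attaining T \<longleftrightarrow> norm_attainment_set T \<noteq> {}"

definition bhatia_semrl ::
    "('k \<Rightarrow> 'x \<Rightarrow> 'x) \<Rightarrow> ('k \<Rightarrow> 'y \<Rightarrow> 'y) \<Rightarrow> ('x::banach \<Rightarrow>\<^sub>L 'y::banach) \<Rightarrow> bool" where
  "bhatia_semrl sX sY T \<longleftrightarrow>
     (\<forall>A \<in> bounded_ops sX sY.
        bj_orthogonal (op_scale sY) T A \<longleftrightarrow>
        (\<exists>x \<in> norm_attainment_set T. bj_orthogonal sY (blinfun_apply T x) (blinfun_apply A x)))"

lemma (in banach_over) bounded_linear_scale: "bounded_linear (scale c)"
proof (rule bounded_linear_intro)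
  show "scale c (r *\<^sub>R x) = r *\<^sub>R scale c x" for r x
    by (metis scale_of_real scale_left_commute)
  show "norm (scale c x) \<le> norm x * norm c" for x
    by (simp add: norm_scale)
qed (rule scale_right_distrib)

lemma op_scale_apply:
  assumes "banach_over sY"
  shows "blinfun_apply (op_scale sY c T) x = sY c (blinfun_apply T x)"
  unfolding op_scale_def
  by (subst bounded_linear_Blinfun_apply)
     (auto intro: bounded_linear_compose banach_over.bounded_linear_scale[OF assms]
        blinfun.bounded_linear_right)

lemma bounded_ops_real: "bounded_ops scaleR scaleR = UNIV"
  by (auto simp: bounded_ops_def blinfun.scaleR_right)

lemma op_scale_real: "op_scale scaleR = scaleR"
  by (intro ext blinfun_eqI)
     (simp add: op_scale_apply[OF banach_over_scaleR] blinfun.scaleR_left)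

text \<open>
  The library's \<^const>\<open>has_bochner_integral\<close> requires a second countable range, which would
  restrict us to separable spaces.  The following is its definition without that constraint. The
  approximation by simple functions makes \<open>f\<close> strongly measurable, so this is the usual Bochner
  integral.
\<close>

definition has_bochner_integral' ::
    "'w measure \<Rightarrow> ('w \<Rightarrow> 'x) \<Rightarrow> 'x::banach \<Rightarrow> bool" where
  "has_bochner_integral' M f v \<longleftrightarrow>
     f \<in> borel_measurable M \<and>
     (\<exists>s. (\<forall>i. Bochner_Integration.simple_bochner_integrable M (s i)) \<and>
          ((\<lambda>i. \<integral>\<^sup>+w. ennreal (norm (f w - s i w)) \<partial>M) \<longlonglongrightarrow> 0) \<and>
          ((\<lambda>i. Bochner_Integration.simple_bochner_integral M (s i)) \<longlonglongrightarrow> v))"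

lemma has_bochner_integral'_eq:
  fixes f :: "'w \<Rightarrow> 'x::{banach, second_countable_topology}"
  shows "has_bochner_integral' M f v \<longleftrightarrow> has_bochner_integral M f v"
  unfolding has_bochner_integral'_def has_bochner_integral.simps by auto

definition vector_measure :: "'w measure \<Rightarrow> ('w set \<Rightarrow> 'x::banach) \<Rightarrow> bool" where
  "vector_measure M G \<longleftrightarrow>
     (\<forall>E :: nat \<Rightarrow> 'w set. range E \<subseteq> sets M \<longrightarrow> disjoint_family E \<longrightarrow>
        (\<lambda>n. G (E n)) sums G (\<Union>n. E n))"

definition bounded_variation :: "'w measure \<Rightarrow> ('w set \<Rightarrow> 'x::banach) \<Rightarrow> bool" where
  "bounded_variation M G \<longleftrightarrow>
     (\<exists>B. \<forall>P. finite P \<longrightarrow> P \<subseteq> sets M \<longrightarrow> partition_on (space M) P \<longrightarrow>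
        (\<Sum>E\<in>P. norm (G E)) \<le> B)"

definition vanishes_on_null_sets :: "'w measure \<Rightarrow> ('w set \<Rightarrow> 'x::banach) \<Rightarrow> bool" where
  "vanishes_on_null_sets M G \<longleftrightarrow> (\<forall>E \<in> null_sets M. G E = 0)"

definition radon_nikodym_wrt :: "'w measure \<Rightarrow> 'x::banach itself \<Rightarrow> bool" where
  "radon_nikodym_wrt M _ \<longleftrightarrow>
     (\<forall>G :: 'w set \<Rightarrow> 'x.
        vector_measure M G \<longrightarrow> bounded_variation M G \<longrightarrow> vanishes_on_null_sets M G \<longrightarrow>
        (\<exists>g. \<forall>E \<in> sets M. has_bochner_integral' M (\<lambda>w. indicator E w *\<^sub>R g w) (G E)))"

text \<open>
  A formula cannot quantify over all types \<open>'w\<close> of sample points, so the measure spaces range over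
  all finite measures, on arbitrary sigma-algebras, whose points are real numbers.  This includes
  Lebesgue measure on the unit interval, which by a classical theorem already determines the
  Radon-Nikodym property, so nothing is lost.  Scalars other than the reals play no role
  in this property.
\<close>

definition radon_nikodym_property :: "'x::banach itself \<Rightarrow> bool" where
  "radon_nikodym_property X \<longleftrightarrow>
     (\<forall>M :: real measure. finite_measure M \<longrightarrow> radon_nikodym_wrt M X)"

end

theory Submission
  imports Defs "HOL-Real_Asymp.Real_Asymp"
begin

text \<open>
  The theorem follows Bourgain's idea.  Let \<open>T\<close> be an operator and put \<open>\<phi> z = \<parallel>T z\<parallel>\<close> on the closed unit
  ball.  An arbitrarily small real functional \<open>f\<close> makes \<open>\<phi> + f\<close> attain a strong maximum over the ball
  at some \<open>x0\<close>: every maximizing sequence converges to \<open>x0\<close> (\<open>exists_strong_maximum\<close>).  Writing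
  \<open>f\<close> as the real part of a scalar functional \<open>g\<close>, the rank one perturbation \<open>S z = T z + g z y0\<close>, with
  \<open>y0\<close> the unit vector in the direction of \<open>T x0\<close> (any unit vector if \<open>T x0 = 0\<close>), attains its norm at \<open>x0\<close>, and any almost norming
  vector of \<open>S\<close> is close to \<open>x0\<close> up to a scalar of modulus one
  (\<open>exists_strongly_exposing_perturbation\<close>).  For such an operator the Bhatia-Semrl property holds
  (\<open>strongly_exposing_bhatia_semrl\<close>): if \<open>S\<close> is orthogonal to \<open>A\<close>, almost norming vectors of
  \<open>S + t c A\<close> tend to \<open>x0\<close>, up to such scalars, as \<open>t\<close> tends to 0, and convexity of \<open>t \<mapsto> \<parallel>S z + t c A z\<parallel>\<close> carries the norm
  inequality over to \<open>t = 1\<close>.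

  The strong maximum comes from the Baire category theorem once small perturbations \<open>\<phi> + f\<close> with a
  slice of small diameter are known to exist (\<open>exists_small_slice\<close>), and this is where the
  Radon-Nikodym property enters.  If all slices of all \<open>\<phi> + f\<close> with \<open>\<parallel>f\<parallel> \<le> \<eta>\<close> have large diameter, a
  Hahn-Banach separation argument (\<open>no_small_slice_imp_averages\<close>) shows that each point \<open>x\<close> of the ball
  has points \<open>z j\<close> at distance at least \<open>\<epsilon>\<close> from \<open>x\<close> whose average \<open>w\<close> satisfies, up to an arbitrarily
  small error, \<open>average of \<phi> (z j) \<ge> \<phi> x + \<eta> \<parallel>w - x\<parallel>\<close>.  Iterating gives a sequence of step functions
  on \<open>[0, 1)\<close> with values in the ball and jumps of size at least \<open>\<epsilon>\<close>, and since \<open>\<phi>\<close> is bounded above,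
  the displacements \<open>\<parallel>w - x\<parallel>\<close> have a finite total mean: the step functions form a quasi-martingale.
  The integrals of these step functions converge to a vector measure.  Its Radon-Nikodym density
  would be the limit in mean of the step functions, contradicting the size of the jumps
  (\<open>not_radon_nikodym\<close>).
\<close>

section \<open>Sublinear functionals and the Hahn-Banach theorem\<close>

text \<open>
  A sublinear functional: subadditive and positively homogeneous, including at the scalar 0.
\<close>

definition sublinear :: "('a::real_vector \<Rightarrow> real) \<Rightarrow> bool" where
  "sublinear q \<longleftrightarrow> (\<forall>x y. q (x + y) \<le> q x + q y) \<and> (\<forall>r\<ge>0. \<forall>x. q (r *\<^sub>R x) = r * q x)"

lemma sublinear_add: "sublinear q \<Longrightarrow> q (x + y) \<le> q x + q y"
  by (simp add: sublinear_def)

lemma sublinear_scale: "sublinear q \<Longrightarrow> 0 \<le> r \<Longrightarrow> q (r *\<^sub>R x) = r * q x"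
  by (simp add: sublinear_def)

lemma sublinear_0: "sublinear q \<Longrightarrow> q 0 = 0"
  using sublinear_scale[of q 0 0] by simp

lemma sublinear_uminus: "sublinear q \<Longrightarrow> - q (- x) \<le> q x"
  using sublinear_add[of q x "- x"] sublinear_0[of q] by simp

lemma sublinearI:
  assumes add: "\<And>x y. q (x + y) \<le> q x + q y"
    and zero: "q 0 = 0"
    and scale: "\<And>r x. 0 < r \<Longrightarrow> q (r *\<^sub>R x) \<le> r * q x"
  shows "sublinear q"
  unfolding sublinear_def
proof (intro conjI allI impI)
  fix r :: real and x assume "0 \<le> r"
  show "q (r *\<^sub>R x) = r * q x"
  proof (cases "r = 0")
    case False
    with \<open>0 \<le> r\<close> have r: "0 < r" by simp
    have "q ((1 / r) *\<^sub>R (r *\<^sub>R x)) \<le> (1 / r) * q (r *\<^sub>R x)"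
      using r by (intro scale) simp
    then have "r * q x \<le> q (r *\<^sub>R x)"
      using r by (simp add: field_simps)
    with scale[OF r, of x] show ?thesis by simp
  qed (simp add: zero)
qed (rule add)

text \<open>
  The pointwise infimum of a chain of sublinear functionals is sublinear, as long as it is finite;
  the bound \<open>q\<close> ensures this, since \<open>h x \<ge> - h (- x) \<ge> - q (- x)\<close>.
\<close>

lemma sublinear_chain_INF:
  assumes "C \<noteq> {}" and sub: "\<And>h. h \<in> C \<Longrightarrow> sublinear h" and le: "\<And>h x. h \<in> C \<Longrightarrow> h x \<le> q x"
    and chain: "\<And>g h. g \<in> C \<Longrightarrow> h \<in> C \<Longrightarrow> g \<le> h \<or> h \<le> g"
  shows "sublinear (\<lambda>x. INF h\<in>C. h x)" and "\<And>h x. h \<in> C \<Longrightarrow> (INF h\<in>C. h x) \<le> h x"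
proof -
  have bdd: "bdd_below ((\<lambda>h. h x) ` C)" for x
  proof (intro bdd_belowI2)
    fix h assume h: "h \<in> C"
    show "- q (- x) \<le> h x"
      using sublinear_uminus[OF sub[OF h], of x] le[OF h, of "- x"] by simp
  qed
  show lower: "(INF h\<in>C. h x) \<le> h x" if "h \<in> C" for h x
    using bdd that by (rule cINF_lower)
  show "sublinear (\<lambda>x. INF h\<in>C. h x)"
  proof (rule sublinearI)
    fix x y
    have *: "(INF h\<in>C. h (x + y)) \<le> g x + h y" if g: "g \<in> C" and h: "h \<in> C" for g h
    proof -
      obtain k where k: "k \<in> C" "k \<le> g" "k \<le> h"
        using chain[OF g h] g h by auto
      have "(INF h\<in>C. h (x + y)) \<le> k (x + y)"
        by (rule lower[OF k(1)])
      also have "\<dots> \<le> k x + k y"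
        by (rule sublinear_add[OF sub[OF k(1)]])
      also have "\<dots> \<le> g x + h y"
        using k by (intro add_mono) (auto simp: le_fun_def)
      finally show ?thesis .
    qed
    have "(INF h\<in>C. h (x + y)) - g x \<le> (INF h\<in>C. h y)" if "g \<in> C" for g
      using *[OF that] by (intro cINF_greatest \<open>C \<noteq> {}\<close>) (simp add: diff_le_eq add.commute)
    then have "(INF h\<in>C. h (x + y)) - (INF h\<in>C. h y) \<le> (INF h\<in>C. h x)"
      by (intro cINF_greatest \<open>C \<noteq> {}\<close>) (simp add: diff_le_eq add.commute)
    then show "(INF h\<in>C. h (x + y)) \<le> (INF h\<in>C. h x) + (INF h\<in>C. h y)" by simp
  next
    have "(\<lambda>h. h 0) ` C = {0}"
      using \<open>C \<noteq> {}\<close> sub sublinear_0 by (auto simp: image_iff)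
    then show "(INF h\<in>C. h 0) = 0" by simp
  next
    fix r :: real and x assume r: "0 < r"
    have "(INF h\<in>C. h (r *\<^sub>R x)) / r \<le> h x" if "h \<in> C" for h
      using lower[OF that, of "r *\<^sub>R x"] sublinear_scale[OF sub[OF that], of r x] r
      by (simp add: field_simps)
    then have "(INF h\<in>C. h (r *\<^sub>R x)) / r \<le> (INF h\<in>C. h x)"
      by (intro cINF_greatest \<open>C \<noteq> {}\<close>)
    with r show "(INF h\<in>C. h (r *\<^sub>R x)) \<le> r * (INF h\<in>C. h x)"
      by (simp add: field_simps)
  qed
qed

text \<open>
  A sublinear functional can be lowered in the direction of \<open>x\<close> so that it remains sublinear. The
  choice \<open>z = - x\<close>, \<open>t = 1\<close> shows that the lowered functional is at most \<open>- q x\<close> at \<open>- x\<close>; hence a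
  minimal sublinear functional is odd, and therefore linear.
\<close>

lemma sublinear_directional:
  fixes x :: "'a::real_vector"
  assumes q: "sublinear q"
  defines "q' \<equiv> \<lambda>z. INF t\<in>{0..}. q (z + t *\<^sub>R x) - t * q x"
  shows "sublinear q'" and "\<And>z t. 0 \<le> t \<Longrightarrow> q' z \<le> q (z + t *\<^sub>R x) - t * q x"
proof -
  have bdd: "bdd_below ((\<lambda>t. q (z + t *\<^sub>R x) - t * q x) ` {0..})" for z
  proof (intro bdd_belowI2)
    fix t :: real assume "t \<in> {0..}"
    then show "- q (- z) \<le> q (z + t *\<^sub>R x) - t * q x"
      using sublinear_add[OF q, of "z + t *\<^sub>R x" "- z"] sublinear_scale[OF q, of t x] by simp
  qed
  show lower: "q' z \<le> q (z + t *\<^sub>R x) - t * q x" if "0 \<le> t" for z t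
    unfolding q'_def using that by (intro cINF_lower bdd) simp
  have greatest: "c \<le> q' z" if "\<And>t. 0 \<le> t \<Longrightarrow> c \<le> q (z + t *\<^sub>R x) - t * q x" for c z
    unfolding q'_def using that by (intro cINF_greatest) auto
  show "sublinear q'"
  proof (rule sublinearI)
    fix y z
    have *: "q' (y + z) \<le> (q (y + s *\<^sub>R x) - s * q x) + (q (z + t *\<^sub>R x) - t * q x)"
      if "0 \<le> s" "0 \<le> t" for s t
      using lower[of "s + t" "y + z"] that
        sublinear_add[OF q, of "y + s *\<^sub>R x" "z + t *\<^sub>R x"] by (simp add: algebra_simps)
    have "q' (y + z) - (q (y + s *\<^sub>R x) - s * q x) \<le> q' z" if "0 \<le> s" for s
      using *[OF that] by (intro greatest) (simp only: diff_le_eq add.commute)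
    then have "q' (y + z) - q' z \<le> q' y"
      by (intro greatest) (simp only: diff_le_eq add.commute)
    then show "q' (y + z) \<le> q' y + q' z" by simp
  next
    show "q' 0 = 0"
      using lower[of 0 0] greatest[of 0 0] sublinear_0[OF q] sublinear_scale[OF q, of _ x] by simp
  next
    fix r :: real and z assume r: "0 < r"
    have "q' (r *\<^sub>R z) / r \<le> q (z + t *\<^sub>R x) - t * q x" if "0 \<le> t" for t
      using lower[of "r * t" "r *\<^sub>R z"] sublinear_scale[OF q, of r "z + t *\<^sub>R x"] r that
      by (simp add: field_simps scaleR_add_right)
    then have "q' (r *\<^sub>R z) / r \<le> q' z" by (rule greatest)
    with r show "q' (r *\<^sub>R z) \<le> r * q' z" by (simp add: field_simps)
  qed
qed

theorem sublinear_dominates_linear: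
  fixes q :: "'a::real_vector \<Rightarrow> real"
  assumes q: "sublinear q"
  shows "\<exists>f :: 'a \<Rightarrow> real. linear f \<and> (\<forall>x. f x \<le> q x)"
proof -
  define A where "A = {h. sublinear h \<and> h \<le> q}"
  let ?P = "\<lambda>g h :: 'a \<Rightarrow> real. h \<le> g"
  have "\<exists>m\<in>A. \<forall>a\<in>A. ?P m a \<longrightarrow> a = m"
  proof (rule predicate_Zorn)
    show "partial_order_on A (relation_of ?P A)"
      by (rule partial_order_on_relation_ofI) auto
    fix C assume C: "C \<in> Chains (relation_of ?P A)"
    show "\<exists>u\<in>A. \<forall>a\<in>C. ?P a u"
    proof (cases "C = {}")
      case True
      then show ?thesis using q by (auto simp: A_def)
    next
      case False
      have sub: "sublinear h" and le: "h x \<le> q x" if "h \<in> C" for h x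
        using C that by (auto simp: Chains_def relation_of_def A_def le_fun_def)
      have chain: "g \<le> h \<or> h \<le> g" if "g \<in> C" "h \<in> C" for g h
        using C that by (auto simp: Chains_def relation_of_def)
      have sub_INF: "sublinear (\<lambda>x. INF h\<in>C. h x)"
        and INF_le: "\<And>h x. h \<in> C \<Longrightarrow> (INF h\<in>C. h x) \<le> h x"
        using sublinear_chain_INF[where C = C and q = q] False sub le chain by (simp_all add: sub le)
      obtain h where h: "h \<in> C" using False by auto
      have "(INF h\<in>C. h x) \<le> q x" for x
        using INF_le[OF h, of x] le[OF h, of x] by auto
      then have "(\<lambda>x. INF h\<in>C. h x) \<in> A"
        using sub_INF by (auto simp: A_def le_fun_def)
      moreover have "(\<lambda>x. INF h\<in>C. h x) \<le> a" if "a \<in> C" for a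
        using INF_le that by (auto simp: le_fun_def)
      ultimately show ?thesis by blast
    qed
  qed
  then obtain m where m: "m \<in> A" and min: "\<And>a. a \<in> A \<Longrightarrow> a \<le> m \<Longrightarrow> a = m"
    by blast
  from m have sub: "sublinear m" and mq: "\<And>x. m x \<le> q x"
    by (auto simp: A_def le_fun_def)
  have neg: "m (- x) = - m x" for x
  proof -
    define m' where "m' z = (INF t\<in>{0..}. m (z + t *\<^sub>R x) - t * m x)" for z
    have sub': "sublinear m'" and le: "m' z \<le> m (z + t *\<^sub>R x) - t * m x" if "0 \<le> t" for z t
      using sublinear_directional[OF sub, where x = x] that by (auto simp: m'_def[abs_def])
    have "m' \<le> m"
      using le[of 0] by (simp add: le_fun_def)
    moreover have "m' \<in> A"
      using sub'[of 0] order_trans[OF \<open>m' \<le> m\<close>] m by (simp add: A_def)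
    ultimately have "m' = m" by (intro min)
    then have "m (- x) \<le> - m x"
      using le[of 1 "- x"] sublinear_0[OF sub] by simp
    then show ?thesis
      using sublinear_uminus[OF sub, of x] by simp
  qed
  have "linear m"
  proof (rule linearI)
    fix x y
    show "m (x + y) = m x + m y"
      using sublinear_add[OF sub, of x y] sublinear_add[OF sub, of "- x" "- y"] neg[of x] neg[of y]
        neg[of "x + y"] by simp
  next
    fix r x
    show "m (r *\<^sub>R x) = r *\<^sub>R m x"
    proof (cases "0 \<le> r")
      case False
      then show ?thesis
        using sublinear_scale[OF sub, of "- r" x] neg[of "r *\<^sub>R x"] by simp
    qed (simp add: sublinear_scale[OF sub])
  qed
  with mq show ?thesis by blast
qed

text \<open>
  The form of the separation theorem used here: if a convex cone \<open>P\<close> of pairs \<open>(w, s)\<close> lies below the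
  graph of \<open>\<eta> * norm\<close>, then some functional of norm at most \<open>\<eta>\<close> separates the two. The functional is
  found below the sublinear functional \<open>q v = inf {\<eta> * norm (v + w) - s | (w, s) \<in> P}\<close>.
\<close>

lemma cone_dominating_functional:
  fixes P :: "('a::real_normed_vector \<times> real) set"
  assumes zero: "(0, 0) \<in> P"
    and add: "\<And>w s w' s'. (w, s) \<in> P \<Longrightarrow> (w', s') \<in> P \<Longrightarrow> (w + w', s + s') \<in> P"
    and scale: "\<And>r w s. 0 < r \<Longrightarrow> (w, s) \<in> P \<Longrightarrow> (r *\<^sub>R w, r * s) \<in> P"
    and dom: "\<And>w s. (w, s) \<in> P \<Longrightarrow> s \<le> \<eta> * norm w" and "0 \<le> \<eta>"
  shows "\<exists>f :: 'a \<Rightarrow>\<^sub>L real. norm f \<le> \<eta> \<and> (\<forall>(w, s)\<in>P. s \<le> blinfun_apply f w)"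
proof -
  define q where "q v = (INF (w, s)\<in>P. \<eta> * norm (v + w) - s)" for v
  have ne: "P \<noteq> {}" using zero by auto
  have bdd: "bdd_below ((\<lambda>(w, s). \<eta> * norm (v + w) - s) ` P)" for v
  proof (intro bdd_belowI2, clarify)
    fix w s assume "(w, s) \<in> P"
    then have "s \<le> \<eta> * norm w" by (rule dom)
    moreover have "norm w \<le> norm (v + w) + norm v"
      using norm_triangle_ineq4[of "v + w" v] by simp
    then have "\<eta> * norm w \<le> \<eta> * norm (v + w) + \<eta> * norm v"
      using \<open>0 \<le> \<eta>\<close> by (metis distrib_left mult_left_mono)
    ultimately show "- (\<eta> * norm v) \<le> \<eta> * norm (v + w) - s" by simp
  qed
  have lower: "q v \<le> \<eta> * norm (v + w) - s" if "(w, s) \<in> P" for v w s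
    unfolding q_def using cINF_lower[OF bdd that, of v] by simp
  have greatest: "c \<le> q v" if "\<And>w s. (w, s) \<in> P \<Longrightarrow> c \<le> \<eta> * norm (v + w) - s" for c v
    unfolding q_def using that by (intro cINF_greatest ne) auto
  have "sublinear q"
  proof (rule sublinearI)
    fix u v
    have *: "q (u + v) \<le> (\<eta> * norm (u + w) - s) + (\<eta> * norm (v + w') - s')"
      if "(w, s) \<in> P" "(w', s') \<in> P" for w s w' s'
    proof -
      have "norm (u + v + (w + w')) \<le> norm (u + w) + norm (v + w')"
        using norm_triangle_ineq[of "u + w" "v + w'"] by (simp add: algebra_simps)
      then have "\<eta> * norm (u + v + (w + w')) \<le> \<eta> * norm (u + w) + \<eta> * norm (v + w')"
        using \<open>0 \<le> \<eta>\<close> by (metis distrib_left mult_left_mono)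
      with lower[OF add[OF that], of "u + v"] show ?thesis by simp
    qed
    have "q (u + v) - (\<eta> * norm (u + w) - s) \<le> q v" if "(w, s) \<in> P" for w s
      using *[OF that] by (intro greatest) (simp only: diff_le_eq add.commute)
    then have "q (u + v) - q v \<le> q u"
      by (intro greatest) (simp only: diff_le_eq add.commute)
    then show "q (u + v) \<le> q u + q v" by simp
  next
    show "q 0 = 0"
      using lower[OF zero, of 0] greatest[of 0 0] dom by simp
  next
    fix r :: real and v assume r: "0 < r"
    have "q (r *\<^sub>R v) / r \<le> \<eta> * norm (v + w) - s" if "(w, s) \<in> P" for w s
    proof -
      have "norm (r *\<^sub>R v + r *\<^sub>R w) = r * norm (v + w)"
        using r by (simp flip: scaleR_add_right)
      with lower[OF scale[OF r that], of "r *\<^sub>R v"] show ?thesis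
        using r by (simp add: field_simps)
    qed
    then have "q (r *\<^sub>R v) / r \<le> q v" by (rule greatest)
    with r show "q (r *\<^sub>R v) \<le> r * q v" by (simp add: field_simps)
  qed
  then obtain f where f: "linear f" "\<And>x. f x \<le> q x"
    using sublinear_dominates_linear by blast
  have le: "f x \<le> \<eta> * norm x" for x
    using f(2)[of x] lower[OF zero, of x] by simp
  have abs: "norm (f x) \<le> \<eta> * norm x" for x
    using le[of x] le[of "- x"] linear_neg[OF f(1), of x] by (simp add: abs_le_iff)
  have "bounded_linear f"
    using f(1) abs by (intro bounded_linear_intro[where K = \<eta>])
      (auto simp: linear_add linear_scale mult.commute)
  then have F: "blinfun_apply (Blinfun f) = f" by (rule bounded_linear_Blinfun_apply)
  have "s \<le> f w" if "(w, s) \<in> P" for w s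
    using f(2)[of "- w"] lower[OF that, of "- w"] linear_neg[OF f(1), of w] by simp
  moreover have "norm (Blinfun f) \<le> \<eta>"
    using abs \<open>0 \<le> \<eta>\<close> by (intro norm_blinfun_bound) (auto simp: F)
  ultimately show ?thesis
    by (intro exI[of _ "Blinfun f"]) (auto simp: F)
qed


section \<open>Averages of points far from the centre of a slice\<close>

text \<open>
  The limits, as \<open>K\<close> grows, of averages of \<open>K\<close> points of \<open>Q\<close>, repetitions allowed. Every convex
  combination of points of \<open>Q\<close> is such a limit; demanding an average for every large \<open>K\<close>, rather than
  for some \<open>K\<close>, makes it possible to use the same number of points for finitely many centres at once.
\<close>

definition average_limits :: "'a::real_normed_vector set \<Rightarrow> 'a set" where
  "average_limits Q = {v. \<exists>z :: nat \<Rightarrow> nat \<Rightarrow> 'a. (\<forall>K. \<forall>j<K. z K j \<in> Q) \<and>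
     (\<lambda>K. (1 / real K) *\<^sub>R (\<Sum>j<K. z K j)) \<longlonglongrightarrow> v}"

lemma subset_average_limits: "Q \<subseteq> average_limits Q"
proof
  fix v assume v: "v \<in> Q"
  have "(\<lambda>K. (1 / real K) *\<^sub>R (\<Sum>j<K. v)) \<longlonglongrightarrow> v"
    by (rule tendsto_eventually, rule eventually_mono[OF eventually_gt_at_top[of 0]])
       (simp add: sum_constant_scaleR)
  with v show "v \<in> average_limits Q"
    unfolding average_limits_def by (intro CollectI exI[of _ "\<lambda>_ _. v"]) simp
qed

lemma convex_average_limits: "convex (average_limits Q)"
proof (rule convexI)
  fix v w and a b :: real
  assume v: "v \<in> average_limits Q" and w: "w \<in> average_limits Q"
    and ab: "0 \<le> a" "0 \<le> b" "a + b = 1"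
  show "a *\<^sub>R v + b *\<^sub>R w \<in> average_limits Q"
  proof (cases "a = 0 \<or> b = 0")
    case False
    with ab have pos: "0 < a" "0 < b" "a < 1" by auto
    obtain y where y: "\<And>K j. j < K \<Longrightarrow> y K j \<in> Q"
      and ylim: "(\<lambda>K. (1 / real K) *\<^sub>R (\<Sum>j<K. y K j)) \<longlonglongrightarrow> v"
      using v unfolding average_limits_def by blast
    obtain z where z: "\<And>K j. j < K \<Longrightarrow> z K j \<in> Q"
      and zlim: "(\<lambda>K. (1 / real K) *\<^sub>R (\<Sum>j<K. z K j)) \<longlonglongrightarrow> w"
      using w unfolding average_limits_def by blast
    \<comment> \<open>Of \<open>K\<close> points, about \<open>a * K\<close> are taken from the averages tending to \<open>v\<close>, the others from those tending to \<open>w\<close>.\<close>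
    define k where "k K = nat \<lfloor>a * real K\<rfloor>" for K
    have kK: "k K \<le> K" for K
    proof -
      have "a * real K \<le> 1 * real K" using pos by (intro mult_right_mono) auto
      then show ?thesis unfolding k_def by linarith
    qed
    have frac: "(\<lambda>K. real (k K) / real K) \<longlonglongrightarrow> a"
    proof -
      have k: "real (k K) = of_int \<lfloor>a * real K\<rfloor>" for K
        unfolding k_def using pos by simp
      show ?thesis unfolding k using pos by real_asymp
    qed
    have frac': "(\<lambda>K. real (K - k K) / real K) \<longlonglongrightarrow> b"
    proof -
      have "(\<lambda>K. 1 - real (k K) / real K) \<longlonglongrightarrow> 1 - a"
        by (intro tendsto_intros frac)
      moreover have "eventually (\<lambda>K. 1 - real (k K) / real K = real (K - k K) / real K) sequentially"
        by (rule eventually_mono[OF eventually_gt_at_top[of 0]]) (simp add: kK of_nat_diff field_simps)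
      ultimately have "(\<lambda>K. real (K - k K) / real K) \<longlonglongrightarrow> 1 - a"
        by (rule Lim_transform_eventually)
      moreover have "1 - a = b" using ab by simp
      ultimately show ?thesis by simp
    qed
    have top: "filterlim k at_top sequentially"
    proof -
      have "filterlim (\<lambda>K. nat \<lfloor>a * real K\<rfloor>) at_top sequentially" using pos by real_asymp
      then show ?thesis by (simp add: k_def[abs_def])
    qed
    have top': "filterlim (\<lambda>K. K - k K) at_top sequentially"
    proof -
      have lim: "filterlim (\<lambda>K. nat \<lfloor>b * real K\<rfloor>) at_top sequentially"
        using pos by real_asymp
      have le: "nat \<lfloor>b * real K\<rfloor> \<le> K - k K" for K
      proof -
        have "a * real K + b * real K = real K"
          using ab by (simp flip: distrib_right)
        moreover have "0 \<le> a * real K" "0 \<le> b * real K" using pos by simp_all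
        ultimately show ?thesis unfolding k_def by linarith
      qed
      show ?thesis
        by (rule filterlim_at_top_mono[OF lim]) (simp add: le)
    qed
    define u where "u K j = (if j < k K then y (k K) j else z (K - k K) (j - k K))" for K j
    have "u K j \<in> Q" if "j < K" for K j
      using that y[of j "k K"] z[of "j - k K" "K - k K"] by (simp add: u_def)
    moreover have "(\<lambda>K. (1 / real K) *\<^sub>R (\<Sum>j<K. u K j)) \<longlonglongrightarrow> a *\<^sub>R v + b *\<^sub>R w"
    proof -
      let ?m = "\<lambda>K. (real (k K) / real K) *\<^sub>R ((1 / real (k K)) *\<^sub>R (\<Sum>j<k K. y (k K) j)) +
        (real (K - k K) / real K) *\<^sub>R ((1 / real (K - k K)) *\<^sub>R (\<Sum>j<K - k K. z (K - k K) j))"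
      have "?m \<longlonglongrightarrow> a *\<^sub>R v + b *\<^sub>R w"
        by (intro tendsto_intros frac frac' filterlim_compose[OF ylim top] filterlim_compose[OF zlim top'])
      moreover have "eventually (\<lambda>K. ?m K = (1 / real K) *\<^sub>R (\<Sum>j<K. u K j)) sequentially"
      proof -
        have split: "(\<Sum>j<m + n. h j) = (\<Sum>j<m. h j) + (\<Sum>j<n. h (m + j))"
          for m n :: nat and h :: "nat \<Rightarrow> 'a"
          by (induction n) (simp_all add: add.assoc)
        have sum: "(\<Sum>j<K. u K j) = (\<Sum>j<k K. y (k K) j) + (\<Sum>j<K - k K. z (K - k K) j)" for K
          using split[of "u K" "k K" "K - k K"] kK[of K] by (simp add: u_def)
        have "eventually (\<lambda>K. 1 \<le> k K) sequentially" "eventually (\<lambda>K. 1 \<le> K - k K) sequentially"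
          using top top' unfolding filterlim_at_top by blast+
        then show ?thesis
          by eventually_elim (simp add: sum scaleR_add_right)
      qed
      ultimately show ?thesis
        by (rule Lim_transform_eventually)
    qed
    ultimately show ?thesis unfolding average_limits_def by blast
  qed (use ab v w in auto)
qed

text \<open>
  Suppose that for no \<open>f\<close> with \<open>norm f \<le> \<eta>\<close> the points of \<open>B\<close> where \<open>\<phi> + f\<close> exceeds its value at \<open>x\<close> minus
  \<open>\<delta>\<close> all lie within \<open>\<epsilon>\<close> of \<open>x\<close>. Then there are points of \<open>B\<close>, at distance at least \<open>\<epsilon>\<close> from \<open>x\<close> and with
  average \<open>w\<close>, over which the average of \<open>\<phi>\<close> is at least \<open>\<phi> x - \<delta> + \<eta> * norm (w - x)\<close>. (Both sides of this
  inequality are multiplied by the number \<open>K\<close> of points.)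
\<close>

lemma no_small_slice_imp_averages:
  fixes \<phi> :: "'a::real_normed_vector \<Rightarrow> real"
  assumes "0 \<le> \<eta>"
    and no_slice: "\<And>f :: 'a \<Rightarrow>\<^sub>L real. norm f \<le> \<eta> \<Longrightarrow>
      \<exists>z\<in>B. \<epsilon> \<le> norm (z - x) \<and> \<phi> x + blinfun_apply f x - \<delta> < \<phi> z + blinfun_apply f z"
  shows "\<forall>\<^sub>F K in sequentially. \<exists>z. (\<forall>j<K. z j \<in> B \<and> \<epsilon> \<le> norm (z j - x)) \<and>
    \<eta> * norm (\<Sum>j<K. z j - x) \<le> (\<Sum>j<K. \<phi> (z j) - \<phi> x + \<delta>)"
proof -
  define Q where "Q = (\<lambda>z. (z - x, \<phi> z - \<phi> x + \<delta>)) ` {z \<in> B. \<epsilon> \<le> norm (z - x)}"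
  define P where "P = insert 0 {r *\<^sub>R v |r v. 0 < r \<and> v \<in> average_limits Q}"
  \<comment> \<open>Otherwise the cone \<open>P\<close> lies below \<open>\<eta> * norm\<close>, and the negative of a separating functional contradicts the hypothesis.\<close>
  have "\<exists>(w, s)\<in>P. \<eta> * norm w < s"
  proof (rule ccontr)
    assume "\<not> ?thesis"
    then have dom: "s \<le> \<eta> * norm w" if "(w, s) \<in> P" for w s
      using that by force
    have add: "p + p' \<in> P" if p: "p \<in> P" and p': "p' \<in> P" for p p'
    proof (cases "p = 0 \<or> p' = 0")
      case False
      then obtain r v r' v' where r: "p = r *\<^sub>R v" "0 < r" "v \<in> average_limits Q"
        and r': "p' = r' *\<^sub>R v'" "0 < r'" "v' \<in> average_limits Q"
        using p p' unfolding P_def by auto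
      define t where "t = r + r'"
      have t: "0 < t" and coeff: "r / t + r' / t = 1"
        using r(2) r'(2) by (auto simp: t_def simp flip: add_divide_distrib)
      have "(r / t) *\<^sub>R v + (r' / t) *\<^sub>R v' \<in> average_limits Q"
        by (rule convexD[OF convex_average_limits r(3) r'(3) _ _ coeff]) (use r(2) r'(2) t in auto)
      moreover have "p + p' = t *\<^sub>R ((r / t) *\<^sub>R v + (r' / t) *\<^sub>R v')"
        using r(1) r'(1) t by (simp add: scaleR_add_right)
      ultimately show ?thesis
        using t unfolding P_def by blast
    qed (use p p' in auto)
    have scale: "c *\<^sub>R p \<in> P" if "0 < c" "p \<in> P" for c p
    proof (cases "p = 0")
      case False
      with that obtain r v where "p = r *\<^sub>R v" "0 < r" "v \<in> average_limits Q"
        unfolding P_def by auto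
      with \<open>0 < c\<close> have "c *\<^sub>R p = (c * r) *\<^sub>R v" "0 < c * r" by simp_all
      with \<open>v \<in> average_limits Q\<close> show ?thesis unfolding P_def by blast
    qed (simp add: P_def)
    obtain f :: "'a \<Rightarrow>\<^sub>L real" where f: "norm f \<le> \<eta>" "\<And>w s. (w, s) \<in> P \<Longrightarrow> s \<le> blinfun_apply f w"
    proof -
      have "\<exists>f :: 'a \<Rightarrow>\<^sub>L real. norm f \<le> \<eta> \<and> (\<forall>(w, s)\<in>P. s \<le> blinfun_apply f w)"
      proof (rule cone_dominating_functional[OF _ _ _ dom \<open>0 \<le> \<eta>\<close>])
        show "(0, 0) \<in> P" by (simp add: P_def zero_prod_def)
        show "(w + w', s + s') \<in> P" if "(w, s) \<in> P" "(w', s') \<in> P" for w s w' s'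
          using add[OF that] by simp
        show "(r *\<^sub>R w, r * s) \<in> P" if "0 < r" "(w, s) \<in> P" for r w s
          using scale[OF that] by simp
      qed
      with that show thesis by blast
    qed
    obtain z where z: "z \<in> B" "\<epsilon> \<le> norm (z - x)" "\<phi> x + blinfun_apply (- f) x - \<delta> < \<phi> z + blinfun_apply (- f) z"
      using no_slice[of "- f"] f(1) by auto
    have "(z - x, \<phi> z - \<phi> x + \<delta>) \<in> average_limits Q"
      using z subset_average_limits[of Q] by (auto simp: Q_def)
    then have "(z - x, \<phi> z - \<phi> x + \<delta>) \<in> P"
      unfolding P_def by (intro insertI2 CollectI exI[of _ 1]) force
    from f(2)[OF this] z(3) show False
      by (simp add: blinfun.diff_right blinfun.minus_left)
  qed
  then obtain w s where ws: "(w, s) \<in> P" "\<eta> * norm w < s" by blast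
  then obtain r v where r: "(w, s) = r *\<^sub>R v" "0 < r" "v \<in> average_limits Q"
    unfolding P_def by (auto simp: zero_prod_def)
  have v: "\<eta> * norm (fst v) < snd v"
    using ws(2) r(1,2) by (cases v) (auto simp: mult.left_commute)
  obtain z where z: "\<And>K j. j < K \<Longrightarrow> z K j \<in> Q"
    and zlim: "(\<lambda>K. (1 / real K) *\<^sub>R (\<Sum>j<K. z K j)) \<longlonglongrightarrow> v"
    using r(3) unfolding average_limits_def by blast
  have "(\<lambda>K. snd ((1 / real K) *\<^sub>R (\<Sum>j<K. z K j)) - \<eta> * norm (fst ((1 / real K) *\<^sub>R (\<Sum>j<K. z K j))))
      \<longlonglongrightarrow> snd v - \<eta> * norm (fst v)"
    by (intro tendsto_intros zlim)
  with v have "\<forall>\<^sub>F K in sequentially. 0 < snd ((1 / real K) *\<^sub>R (\<Sum>j<K. z K j)) -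
      \<eta> * norm (fst ((1 / real K) *\<^sub>R (\<Sum>j<K. z K j)))"
    by (intro order_tendstoD(1)) auto
  then show ?thesis
    using eventually_gt_at_top[of "0::nat"]
  proof eventually_elim
    case (elim K)
    have eq: "z K j = (fst (z K j), \<phi> (fst (z K j) + x) - \<phi> x + \<delta>)"
      and mem: "fst (z K j) + x \<in> B" "\<epsilon> \<le> norm (fst (z K j))" if "j < K" for j
      using z[OF that] unfolding Q_def by auto
    have "snd (\<Sum>j<K. z K j) = (\<Sum>j<K. \<phi> (fst (z K j) + x) - \<phi> x + \<delta>)"
      unfolding snd_sum by (intro sum.cong refl) (subst eq, auto)
    moreover have "\<eta> * norm (fst (\<Sum>j<K. z K j)) < snd (\<Sum>j<K. z K j)"
      using elim by (simp add: field_simps)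
    ultimately show ?case
      using mem by (intro exI[of _ "\<lambda>j. fst (z K j) + x"]) (simp add: fst_sum)
  qed
qed


section \<open>Lebesgue measure on the unit interval and approximation by cells\<close>

text \<open>
  Lebesgue measure on \<open>[0, 1)\<close>, regarded as a probability measure on the Borel sets of the real line.
\<close>

abbreviation unit_measure :: "real measure" where
  "unit_measure \<equiv> uniform_measure lborel {0..<1}"

text \<open>
  For \<open>0 < N\<close>, the interval \<open>[i / N, (i + 1) / N)\<close>. The definition by the integer part makes
  refinement a matter of integer division.
\<close>

definition cell :: "nat \<Rightarrow> nat \<Rightarrow> real set" where
  "cell N i = {w. \<lfloor>real N * w\<rfloor> = int i}"

lemma measure_unit_measure: "E \<in> sets borel \<Longrightarrow> measure unit_measure E = measure lborel ({0..<1} \<inter> E)"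
  by (subst measure_uniform_measure) auto

lemma finite_unit_measure: "finite_measure unit_measure" "measure unit_measure UNIV = 1"
proof -
  have "emeasure unit_measure UNIV = 1"
    by (subst emeasure_uniform_measure) auto
  then show "finite_measure unit_measure" "measure unit_measure UNIV = 1"
    by (intro finite_measureI; simp del: emeasure_uniform_measure) (simp add: measure_def)
qed

lemma AE_unit_measure: "AE w in unit_measure. w \<in> {0..<1}"
  by (rule AE_uniform_measureI) auto

lemma measure_unit_measure_cong:
  assumes "A \<in> sets borel" "B \<in> sets borel" "\<And>w. w \<in> {0..<1} \<Longrightarrow> w \<in> A \<longleftrightarrow> w \<in> B"
  shows "measure unit_measure A = measure unit_measure B"
proof -
  have "{0..<1} \<inter> A = {0..<1} \<inter> B" using assms(3) by auto
  then show ?thesis using assms(1,2) by (simp add: measure_unit_measure)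
qed

lemma cell_eq: "0 < N \<Longrightarrow> cell N i = {real i / real N..<real (Suc i) / real N}"
  by (auto simp: cell_def floor_eq_iff pos_divide_le_eq pos_less_divide_eq mult.commute add.commute)

lemma cell_borel [measurable, simp]: "cell N i \<in> sets borel"
proof -
  have "cell N i = {w. real i \<le> real N * w \<and> real N * w < real i + 1}"
    by (auto simp: cell_def floor_eq_iff)
  then show ?thesis by simp
qed

lemma measure_cell:
  assumes "i < N"
  shows "measure unit_measure (cell N i) = 1 / real N"
proof -
  have "real (Suc i) \<le> real N" using assms by simp
  then have "cell N i \<subseteq> {0..<1}"
    using assms by (auto simp: cell_eq field_simps intro: order_less_le_trans)
  then have "{0..<1} \<inter> cell N i = cell N i" by blast
  then show ?thesis
    using assms by (simp add: measure_unit_measure) (simp add: cell_eq field_simps)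
qed

lemma cell_disjoint: "i \<noteq> j \<Longrightarrow> cell N i \<inter> cell N j = {}"
  by (auto simp: cell_def)

lemma cell_cover:
  assumes "0 < N" "w \<in> {0..<1}"
  shows "nat \<lfloor>real N * w\<rfloor> < N" "w \<in> cell N i \<longleftrightarrow> nat \<lfloor>real N * w\<rfloor> = i"
proof -
  have "real N * w < real N * 1" using assms by (intro mult_strict_left_mono) auto
  then have "\<lfloor>real N * w\<rfloor> < int N" by linarith
  then show "nat \<lfloor>real N * w\<rfloor> < N" using assms by (simp add: nat_less_iff)
  have "0 \<le> real N * w" using assms by simp
  then show "w \<in> cell N i \<longleftrightarrow> nat \<lfloor>real N * w\<rfloor> = i"
    unfolding cell_def by auto
qed

lemma cell_refine:
  assumes "w \<in> cell (N * K) l" "0 < K"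
  shows "w \<in> cell N (l div K)"
proof -
  have "\<lfloor>(real (N * K) * w) / real_of_int (int K)\<rfloor> = \<lfloor>real (N * K) * w\<rfloor> div int K"
    by (rule floor_divide_real_eq_div) simp
  moreover have "(real (N * K) * w) / real_of_int (int K) = real N * w"
    using assms(2) by simp
  ultimately show ?thesis
    using assms by (simp add: cell_def zdiv_int)
qed

lemma measure_eq_sum_cells:
  assumes "0 < N" and E: "E \<in> sets borel"
  shows "measure unit_measure E = (\<Sum>i<N. measure unit_measure (E \<inter> cell N i))"
proof -
  interpret finite_measure unit_measure by (rule finite_unit_measure)
  have "measure unit_measure E = measure unit_measure (\<Union>i\<in>{..<N}. E \<inter> cell N i)"
    using cell_cover[OF \<open>0 < N\<close>] E by (intro measure_unit_measure_cong) auto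
  also have "\<dots> = (\<Sum>i<N. measure unit_measure (E \<inter> cell N i))"
    using E cell_disjoint by (intro finite_measure_finite_Union) (auto simp: disjoint_family_on_def)
  finally show ?thesis .
qed

lemma measure_cell_le: "0 < N \<Longrightarrow> measure unit_measure (cell N i) \<le> 1 / real N"
proof (cases "i < N")
  case False
  assume N: "0 < N"
  have "measure unit_measure (cell N i) = measure unit_measure {}"
    using cell_cover[OF N] False by (intro measure_unit_measure_cong) auto
  then show ?thesis by simp
qed (simp only: measure_cell order_refl)

text \<open>
  Borel sets are approximated in measure by unions of cells of every sufficiently fine subdivision. The
  sets with this property contain the half lines, where at most one cell is in doubt, and are closed
  under complements and countable unions.
\<close>

lemma borel_approx_cells:
  assumes "E \<in> sets borel" "0 < \<epsilon>"
  shows "\<forall>\<^sub>F N in sequentially. \<exists>S\<subseteq>{..<N}. measure unit_measure (sym_diff E (\<Union>i\<in>S. cell N i)) < \<epsilon>"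
proof -
  interpret finite_measure unit_measure by (rule finite_unit_measure)
  have "E \<in> sigma_sets UNIV (range lessThan)"
    using assms(1) by (simp add: borel_Iio)
  then show ?thesis
    using \<open>0 < \<epsilon>\<close>
  proof (induction arbitrary: \<epsilon> rule: sigma_sets.induct)
    case (Basic E)
    then obtain a where E: "E = {..<a}" by auto
    have "\<forall>\<^sub>F N in sequentially. 1 / real N < \<epsilon>"
      using \<open>0 < \<epsilon>\<close> by real_asymp
    then show ?case
      using eventually_gt_at_top[of "0::nat"]
    proof eventually_elim
      case (elim N)
      let ?S = "{i. i < N \<and> real (Suc i) \<le> real N * a}"
      let ?D = "sym_diff E (\<Union>i\<in>?S. cell N i)"
      have "w \<in> cell N (nat \<lfloor>real N * a\<rfloor>)" if w: "w \<in> {0..<1}" "w \<in> ?D" for w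
      proof -
        define i where "i = nat \<lfloor>real N * w\<rfloor>"
        have i: "i < N" "w \<in> cell N i"
          using cell_cover[OF \<open>0 < N\<close> w(1)] by (auto simp: i_def)
        then have iw: "real i / N \<le> w" "w < real (Suc i) / N"
          using \<open>0 < N\<close> by (auto simp: cell_eq)
        have mem: "w \<in> (\<Union>i\<in>?S. cell N i) \<longleftrightarrow> i \<in> ?S"
          using cell_cover(2)[OF \<open>0 < N\<close> w(1)] by (auto simp: i_def)
        have lt: "w < a" if "real (Suc i) \<le> real N * a"
        proof -
          have "real (Suc i) / N \<le> a" using that \<open>0 < N\<close> by (simp add: divide_le_eq mult.commute)
          with iw(2) show ?thesis by simp
        qed
        have "w < a \<and> i \<notin> ?S \<or> i \<in> ?S \<and> \<not> w < a"
          using w(2) unfolding E Un_iff Diff_iff mem lessThan_iff by blast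
        then have "w < a" "real N * a < real (Suc i)"
          using i(1) lt by (auto simp: not_le)
        moreover have "real i \<le> real N * w" using iw \<open>0 < N\<close> by (simp add: field_simps)
        moreover have "real N * w < real N * a" using \<open>w < a\<close> \<open>0 < N\<close> by simp
        ultimately have "\<lfloor>real N * a\<rfloor> = int i" by linarith
        then show ?thesis using i by simp
      qed
      then have "measure unit_measure ?D =
          measure unit_measure (?D \<inter> cell N (nat \<lfloor>real N * a\<rfloor>))"
        by (intro measure_unit_measure_cong) (auto simp: E)
      also have "\<dots> \<le> measure unit_measure (cell N (nat \<lfloor>real N * a\<rfloor>))"
        by (intro finite_measure_mono) (auto simp: E)
      also have "\<dots> < \<epsilon>"
        by (rule order_le_less_trans[OF measure_cell_le]) (use elim in simp_all)
      finally show ?case by (intro exI[of _ ?S]) auto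
    qed
  next
    case Empty
    then show ?case
      by (intro always_eventually allI exI[of _ "{}"]) simp
  next
    case (Compl E)
    have E[measurable]: "E \<in> sets borel"
      using Compl.hyps by (simp add: borel_Iio)
    show ?case
      using Compl.IH[OF Compl.prems] eventually_gt_at_top[of "0::nat"]
    proof eventually_elim
      case (elim N)
      then obtain S where S: "S \<subseteq> {..<N}"
        "measure unit_measure (sym_diff E (\<Union>i\<in>S. cell N i)) < \<epsilon>" by blast
      have "finite S" using S(1) finite_subset by blast
      have "measure unit_measure (sym_diff (UNIV - E) (\<Union>i\<in>{..<N} - S. cell N i)) =
          measure unit_measure (sym_diff E (\<Union>i\<in>S. cell N i))"
        using \<open>finite S\<close> cell_cover[OF \<open>0 < N\<close>] by (intro measure_unit_measure_cong) auto
      with S(2) show ?case by (intro exI[of _ "{..<N} - S"]) auto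
    qed
  next
    case (Union E)
    have E[measurable]: "E n \<in> sets borel" for n
      using Union.hyps[of n] by (simp add: borel_Iio)
    have "(\<lambda>k. measure unit_measure (\<Union>n<k. E n)) \<longlonglongrightarrow> measure unit_measure (\<Union>k. \<Union>n<k. E n)"
      by (intro finite_Lim_measure_incseq) (auto simp: incseq_def intro: less_le_trans)
    moreover have "(\<Union>k. \<Union>n<k. E n) = (\<Union>n. E n)" by auto
    ultimately have "\<forall>\<^sub>F k in sequentially. measure unit_measure (\<Union>n. E n) - \<epsilon> / 2 < measure unit_measure (\<Union>n<k. E n)"
      using \<open>0 < \<epsilon>\<close> by (intro order_tendstoD(1)) auto
    then obtain k where k: "measure unit_measure (\<Union>n. E n) - \<epsilon> / 2 < measure unit_measure (\<Union>n<k. E n)"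
      by (auto simp: eventually_sequentially)
    have tail: "measure unit_measure ((\<Union>n. E n) - (\<Union>n<k. E n)) < \<epsilon> / 2"
      using k by (subst finite_measure_Diff) auto
    define \<delta> where "\<delta> = \<epsilon> / 2 / (real k + 1)"
    have "0 < \<delta>" using \<open>0 < \<epsilon>\<close> by (simp add: \<delta>_def)
    have "\<forall>\<^sub>F N in sequentially. \<forall>n\<in>{..<k}. \<exists>S\<subseteq>{..<N}. measure unit_measure (sym_diff (E n) (\<Union>i\<in>S. cell N i)) < \<delta>"
      by (intro eventually_ball_finite finite_lessThan ballI Union.IH \<open>0 < \<delta>\<close>)
    then show ?case
    proof eventually_elim
      case (elim N)
      then obtain S where S: "\<And>n. n < k \<Longrightarrow> S n \<subseteq> {..<N}"
        "\<And>n. n < k \<Longrightarrow> measure unit_measure (sym_diff (E n) (\<Union>i\<in>S n. cell N i)) < \<delta>"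
        by (metis lessThan_iff)
      have fin: "finite (S n)" if "n < k" for n using S(1)[OF that] finite_subset by blast
      let ?D = "\<lambda>n. sym_diff (E n) (\<Union>i\<in>S n. cell N i)"
      have D: "?D n \<in> sets borel" if "n < k" for n using fin[OF that] by auto
      have "measure unit_measure (sym_diff (\<Union>n. E n) (\<Union>i\<in>(\<Union>n<k. S n). cell N i))
          \<le> measure unit_measure (((\<Union>n. E n) - (\<Union>n<k. E n)) \<union> (\<Union>n\<in>{..<k}. ?D n))"
        using D by (intro finite_measure_mono) (auto intro!: sets.Un sets.finite_UN)
      also have "\<dots> \<le> measure unit_measure ((\<Union>n. E n) - (\<Union>n<k. E n)) + measure unit_measure (\<Union>n\<in>{..<k}. ?D n)"
        using D by (intro measure_Un_le) (auto intro!: sets.finite_UN)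
      also have "measure unit_measure (\<Union>n\<in>{..<k}. ?D n) \<le> (\<Sum>n<k. measure unit_measure (?D n))"
        using D by (intro finite_measure_subadditive_finite) auto
      also have "\<dots> \<le> (\<Sum>n<k. \<delta>)"
        using S(2) by (intro sum_mono less_imp_le) auto
      also have "\<dots> \<le> \<epsilon> / 2"
        using \<open>0 < \<epsilon>\<close> by (simp add: \<delta>_def field_simps)
      finally show ?case
        using tail S(1) by (intro exI[of _ "\<Union>n<k. S n"]) (auto simp: subset_iff)
    qed
  qed
qed

lemma simple_function_approx_cells:
  fixes s :: "real \<Rightarrow> 'a::real_normed_vector"
  assumes s: "simple_function unit_measure s" and "0 < \<epsilon>"
  shows "\<forall>\<^sub>F N in sequentially. \<exists>c. (\<integral>\<^sup>+ w. norm (s w - c (nat \<lfloor>real N * w\<rfloor>)) \<partial>unit_measure) < ennreal \<epsilon>"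
proof -
  interpret finite_measure unit_measure by (rule finite_unit_measure)
  have fin: "finite (range s)" and B: "\<And>y. y \<in> range s \<Longrightarrow> s -` {y} \<in> sets borel"
    using s unfolding simple_function_def by auto
  define D where "D N S y = sym_diff (s -` {y}) (\<Union>i\<in>S y. cell N i)" for N S y
  define \<delta> where "\<delta> = \<epsilon> / ((\<Sum>y\<in>range s. norm y) + 1)"
  have pos: "0 < (\<Sum>y\<in>range s. norm y) + 1"
    by (intro add_nonneg_pos sum_nonneg) auto
  then have "0 < \<delta>" using \<open>0 < \<epsilon>\<close> by (simp add: \<delta>_def)
  have "\<forall>\<^sub>F N in sequentially. \<forall>y\<in>range s. \<exists>S\<subseteq>{..<N}.
      measure unit_measure (sym_diff (s -` {y}) (\<Union>i\<in>S. cell N i)) < \<delta>"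
    by (intro eventually_ball_finite fin ballI borel_approx_cells B \<open>0 < \<delta>\<close>)
  then show ?thesis
    using eventually_gt_at_top[of "0::nat"]
  proof eventually_elim
    case (elim N)
    then obtain S where S: "\<And>y. y \<in> range s \<Longrightarrow> S y \<subseteq> {..<N}"
      and less: "\<And>y. y \<in> range s \<Longrightarrow> measure unit_measure (D N S y) < \<delta>"
      unfolding D_def by metis
    have D: "D N S y \<in> sets borel" if "y \<in> range s" for y
      using B[OF that] finite_subset[OF S[OF that]] unfolding D_def by auto
    define c where "c i = (\<Sum>y\<in>range s. if i \<in> S y then y else 0)" for i
    have point: "norm (s w - c (nat \<lfloor>real N * w\<rfloor>)) \<le> (\<Sum>y\<in>range s. norm y * indicator (D N S y) w)"
      if w: "w \<in> {0..<1}" for w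
    proof -
      define i where "i = nat \<lfloor>real N * w\<rfloor>"
      have mem: "w \<in> (\<Union>j\<in>S y. cell N j) \<longleftrightarrow> i \<in> S y" for y
        using cell_cover(2)[OF \<open>0 < N\<close> w] by (auto simp: i_def)
      have "s w = (\<Sum>y\<in>range s. if s w = y then y else 0)"
        using fin by simp
      then have "s w - c i = (\<Sum>y\<in>range s. (if s w = y then y else 0) - (if i \<in> S y then y else 0))"
        by (simp add: c_def sum_subtractf)
      also have "norm \<dots> \<le> (\<Sum>y\<in>range s. norm ((if s w = y then y else 0) - (if i \<in> S y then y else 0)))"
        by (rule norm_sum)
      also have "\<dots> \<le> (\<Sum>y\<in>range s. norm y * indicator (D N S y) w)"
        by (intro sum_mono) (use mem in \<open>auto simp: D_def indicator_def\<close>)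
      finally show ?thesis by (simp add: i_def)
    qed
    have "(\<integral>\<^sup>+ w. norm (s w - c (nat \<lfloor>real N * w\<rfloor>)) \<partial>unit_measure) \<le>
        (\<integral>\<^sup>+ w. (\<Sum>y\<in>range s. ennreal (norm y) * indicator (D N S y) w) \<partial>unit_measure)"
    proof (rule nn_integral_mono_AE)
      have eq: "(\<Sum>y\<in>range s. ennreal (norm y) * indicator (D N S y) w) =
          ennreal (\<Sum>y\<in>range s. norm y * indicator (D N S y) w)" for w
        by (subst sum_ennreal[symmetric]) (auto simp: ennreal_mult ennreal_indicator)
      show "AE w in unit_measure. ennreal (norm (s w - c (nat \<lfloor>real N * w\<rfloor>))) \<le>
          (\<Sum>y\<in>range s. ennreal (norm y) * indicator (D N S y) w)"
        using AE_unit_measure by eventually_elim (simp only: eq point ennreal_leI)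
    qed
    also have "\<dots> = (\<Sum>y\<in>range s. ennreal (norm y) * emeasure unit_measure (D N S y))"
      using D by (subst nn_integral_sum) (auto intro!: sum.cong nn_integral_cmult_indicator simp del: emeasure_uniform_measure)
    also have "\<dots> = ennreal (\<Sum>y\<in>range s. norm y * measure unit_measure (D N S y))"
      by (subst sum_ennreal[symmetric]) (auto simp: ennreal_mult emeasure_eq_measure simp del: emeasure_uniform_measure measure_uniform_measure)
    also have "\<dots> < ennreal \<epsilon>"
    proof (rule ennreal_lessI[OF \<open>0 < \<epsilon>\<close>])
      have "(\<Sum>y\<in>range s. norm y * measure unit_measure (D N S y)) \<le> (\<Sum>y\<in>range s. norm y * \<delta>)"
        by (intro sum_mono mult_left_mono[OF less_imp_le[OF less] norm_ge_zero])
      also have "(\<Sum>y\<in>range s. norm y * \<delta>) < \<epsilon>"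
      proof -
        define n where "n = (\<Sum>y\<in>range s. norm y)"
        have "(\<Sum>y\<in>range s. norm y * \<delta>) = n * (\<epsilon> / (n + 1))"
          by (simp only: n_def \<delta>_def sum_distrib_right)
        also have "\<dots> < \<epsilon>"
          using pos \<open>0 < \<epsilon>\<close> unfolding n_def[symmetric] by (simp add: field_simps)
        finally show ?thesis .
      qed
      finally show "(\<Sum>y\<in>range s. norm y * measure unit_measure (D N S y)) < \<epsilon>" .
    qed
    finally show ?case by blast
  qed
qed

text \<open>
  Differences of measurable functions need not be measurable in a non-separable space, but subtracting a
  function with finitely many values is harmless.
\<close>

lemma measurable_norm_diff_simple:
  fixes f s :: "'w \<Rightarrow> 'a::real_normed_vector"
  assumes f: "f \<in> borel_measurable M" and s: "simple_function M s"
  shows "(\<lambda>w. norm (f w - s w)) \<in> borel_measurable M"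
proof (rule measurable_compose_countable'[where f = "\<lambda>y w. norm (f w - y)" and I = "s ` space M"])
  show "(\<lambda>w. norm (f w - y)) \<in> borel_measurable M" for y
    by (rule measurable_compose[OF f]) (intro borel_measurable_continuous_onI continuous_intros)
  show "countable (s ` space M)"
    using s by (simp add: simple_function_def countable_finite)
  then show "s \<in> measurable M (count_space (s ` space M))"
    using s by (auto simp: measurable_count_space_eq_countable simple_function_def)
qed

text \<open>
  The Bochner integral differs from the integral of a simple function by at most the distance in mean.
\<close>

lemma has_bochner_integral'_bound:
  assumes f: "has_bochner_integral' M f v" and t: "Bochner_Integration.simple_bochner_integrable M t"
  shows "ennreal (norm (v - Bochner_Integration.simple_bochner_integral M t)) \<le> (\<integral>\<^sup>+ w. norm (f w - t w) \<partial>M)"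
proof -
  obtain s where meas: "f \<in> borel_measurable M"
    and s: "\<And>i. Bochner_Integration.simple_bochner_integrable M (s i)"
    and lim0: "(\<lambda>i. \<integral>\<^sup>+w. ennreal (norm (f w - s i w)) \<partial>M) \<longlonglongrightarrow> 0"
    and lim: "(\<lambda>i. Bochner_Integration.simple_bochner_integral M (s i)) \<longlonglongrightarrow> v"
    using f unfolding has_bochner_integral'_def by blast
  have sf: "simple_function M (s i)" "simple_function M t" for i
    using s t by (auto elim: simple_bochner_integrable.cases)
  have bound: "ennreal (norm (Bochner_Integration.simple_bochner_integral M (s i) - Bochner_Integration.simple_bochner_integral M t)) \<le>
      (\<integral>\<^sup>+w. norm (f w - s i w) \<partial>M) + (\<integral>\<^sup>+w. norm (f w - t w) \<partial>M)" for i
  proof -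
    have int: "Bochner_Integration.simple_bochner_integrable M (\<lambda>w. s i w - t w)"
      using simple_bochner_integrable_compose2[of "(-)" M "s i" t] s t by simp
    have int': "Bochner_Integration.simple_bochner_integrable M (\<lambda>w. norm (s i w - t w))"
      using simple_bochner_integrable_compose2[of "\<lambda>x y. norm (x - y)" M "s i" t] s t by simp
    have "ennreal (norm (Bochner_Integration.simple_bochner_integral M (s i) - Bochner_Integration.simple_bochner_integral M t)) =
        norm (Bochner_Integration.simple_bochner_integral M (\<lambda>w. s i w - t w))"
      using s t by (subst simple_bochner_integral_diff) auto
    also have "\<dots> \<le> Bochner_Integration.simple_bochner_integral M (\<lambda>w. norm (s i w - t w))"
      using int by (intro ennreal_leI simple_bochner_integral_norm_bound)
    also have "\<dots> = (\<integral>\<^sup>+w. norm (s i w - t w) \<partial>M)"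
      using int' by (intro simple_bochner_integral_eq_nn_integral) auto
    also have "\<dots> \<le> (\<integral>\<^sup>+w. ennreal (norm (f w - s i w)) + ennreal (norm (f w - t w)) \<partial>M)"
    proof (rule nn_integral_mono)
      fix w
      have "norm (s i w - t w) \<le> norm (f w - s i w) + norm (f w - t w)"
        by (metis norm_diff_triangle_le norm_minus_commute order_refl)
      then show "ennreal (norm (s i w - t w)) \<le> ennreal (norm (f w - s i w)) + ennreal (norm (f w - t w))"
        by (simp flip: ennreal_plus)
    qed
    also have "\<dots> = (\<integral>\<^sup>+w. norm (f w - s i w) \<partial>M) + (\<integral>\<^sup>+w. norm (f w - t w) \<partial>M)"
      using measurable_norm_diff_simple[OF meas] sf by (intro nn_integral_add) auto
    finally show ?thesis .
  qed
  have "(\<lambda>i. ennreal (norm (Bochner_Integration.simple_bochner_integral M (s i) - Bochner_Integration.simple_bochner_integral M t)))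
      \<longlonglongrightarrow> ennreal (norm (v - Bochner_Integration.simple_bochner_integral M t))"
    by (intro tendsto_intros lim)
  moreover have "(\<lambda>i. (\<integral>\<^sup>+w. norm (f w - s i w) \<partial>M) + (\<integral>\<^sup>+w. norm (f w - t w) \<partial>M))
      \<longlonglongrightarrow> 0 + (\<integral>\<^sup>+w. norm (f w - t w) \<partial>M)"
    by (intro tendsto_intros lim0)
  ultimately show ?thesis
    unfolding add_0 by (rule LIMSEQ_le) (use bound in blast)
qed

lemma simple_bochner_integral_indicator:
  fixes y :: "'a::real_normed_vector" and M :: "'b measure"
  assumes A: "A \<in> sets M" and fin: "emeasure M A < \<infinity>"
  shows "Bochner_Integration.simple_bochner_integrable M (\<lambda>w. indicator A w *\<^sub>R y)"
    and "Bochner_Integration.simple_bochner_integral M (\<lambda>w. indicator A w *\<^sub>R y) = measure M A *\<^sub>R y"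
proof -
  have sbi: "Bochner_Integration.simple_bochner_integrable M (indicator A :: 'b \<Rightarrow> real)"
  proof
    have "{w \<in> space M. (indicator A w :: real) \<noteq> 0} = A"
      using sets.sets_into_space[OF A] by (auto split: split_indicator)
    then show "emeasure M {w \<in> space M. (indicator A w :: real) \<noteq> 0} \<noteq> \<infinity>"
      using fin by auto
  qed (rule simple_function_indicator A)+
  then show "Bochner_Integration.simple_bochner_integrable M (\<lambda>w. indicator A w *\<^sub>R y)"
    using simple_bochner_integrable_compose2[of "\<lambda>r _. r *\<^sub>R y" M "indicator A" "indicator A"] by simp
  have "Bochner_Integration.simple_bochner_integral M (indicator A) = measure M A"
    using simple_bochner_integral_eq_nn_integral[OF sbi] A fin
    by (simp add: ennreal_indicator emeasure_eq_ennreal_measure)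
  moreover have "linear (\<lambda>r. r *\<^sub>R y)" by (rule linearI) (simp_all add: scaleR_add_left)
  from simple_bochner_integral_linear[OF this sbi]
  have "Bochner_Integration.simple_bochner_integral M (\<lambda>w. indicator A w *\<^sub>R y) =
      Bochner_Integration.simple_bochner_integral M (indicator A) *\<^sub>R y" .
  ultimately show "Bochner_Integration.simple_bochner_integral M (\<lambda>w. indicator A w *\<^sub>R y) = measure M A *\<^sub>R y"
    by simp
qed

text \<open>
  If \<open>G\<close> has the Bochner density \<open>g\<close>, then for every fine enough subdivision into \<open>N\<close> cells there are
  constants \<open>c\<close>, one for each cell, that nearly represent \<open>G\<close> on all cells of all refinements of that
  subdivision: the total error is at most the distance in mean between \<open>g\<close> and the step function with
  values \<open>c\<close>. The quotient \<open>l div K\<close> is the index of the coarse cell that contains the fine cell \<open>l\<close>.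
\<close>

lemma derivative_approx_cells:
  fixes g :: "real \<Rightarrow> 'a::banach"
  assumes int: "\<And>E. E \<in> sets borel \<Longrightarrow>
      has_bochner_integral' unit_measure (\<lambda>w. indicator E w *\<^sub>R g w) (G E)"
    and "0 < \<epsilon>"
  shows "\<forall>\<^sub>F N in sequentially. \<exists>c. \<forall>K>0.
    (\<Sum>l<N * K. norm (G (cell (N * K) l) - (1 / real (N * K)) *\<^sub>R c (l div K))) < \<epsilon>"
proof -
  interpret finite_measure unit_measure by (rule finite_unit_measure)
  obtain s where meas: "g \<in> borel_measurable unit_measure"
    and s: "\<And>i. Bochner_Integration.simple_bochner_integrable unit_measure (s i)"
    and lim: "(\<lambda>i. \<integral>\<^sup>+w. ennreal (norm (g w - s i w)) \<partial>unit_measure) \<longlonglongrightarrow> 0"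
    using int[of UNIV] unfolding has_bochner_integral'_def by auto
  have "\<forall>\<^sub>F i in sequentially. (\<integral>\<^sup>+w. ennreal (norm (g w - s i w)) \<partial>unit_measure) < ennreal (\<epsilon> / 2)"
    using lim \<open>0 < \<epsilon>\<close> by (intro order_tendstoD(2)) auto
  then obtain i where i: "(\<integral>\<^sup>+w. ennreal (norm (g w - s i w)) \<partial>unit_measure) < ennreal (\<epsilon> / 2)"
    by (auto simp: eventually_sequentially)
  have sf: "simple_function unit_measure (s i)"
    using s by (auto elim: simple_bochner_integrable.cases)
  then have [measurable]: "s i \<in> measurable unit_measure (count_space UNIV)"
    by (rule measurable_simple_function)
  have "\<forall>\<^sub>F N in sequentially. \<exists>c. (\<integral>\<^sup>+ w. norm (s i w - c (nat \<lfloor>real N * w\<rfloor>)) \<partial>unit_measure) < ennreal (\<epsilon> / 2)"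
    using \<open>0 < \<epsilon>\<close> by (intro simple_function_approx_cells sf) simp
  then show ?thesis
    using eventually_gt_at_top[of "0::nat"]
  proof eventually_elim
    case (elim N)
    then obtain c where c: "(\<integral>\<^sup>+ w. norm (s i w - c (nat \<lfloor>real N * w\<rfloor>)) \<partial>unit_measure) < ennreal (\<epsilon> / 2)"
      by blast
    let ?h = "\<lambda>w. norm (g w - c (nat \<lfloor>real N * w\<rfloor>))"
    have meas_h: "?h \<in> borel_measurable unit_measure"
    proof (rule measurable_compose_countable[where f = "\<lambda>k w. norm (g w - c k)"])
      show "(\<lambda>w. norm (g w - c k)) \<in> borel_measurable unit_measure" for k
        by (rule measurable_compose[OF meas]) (intro borel_measurable_continuous_onI continuous_intros)
    qed measurable
    have meas_s: "(\<lambda>w. norm (s i w - c (nat \<lfloor>real N * w\<rfloor>))) \<in> borel_measurable unit_measure"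
    proof (rule measurable_compose_countable[where f = "\<lambda>k w. norm (s i w - c k)"])
      show "(\<lambda>w. norm (s i w - c k)) \<in> borel_measurable unit_measure" for k
        by (rule measurable_compose[of "s i" _ "count_space UNIV"]) measurable
    qed measurable
    have "(\<integral>\<^sup>+ w. ?h w \<partial>unit_measure) \<le>
        (\<integral>\<^sup>+ w. ennreal (norm (g w - s i w)) + ennreal (norm (s i w - c (nat \<lfloor>real N * w\<rfloor>))) \<partial>unit_measure)"
    proof (rule nn_integral_mono)
      fix w
      have "?h w \<le> norm (g w - s i w) + norm (s i w - c (nat \<lfloor>real N * w\<rfloor>))"
        by (metis norm_diff_triangle_le order_refl)
      then show "ennreal (?h w) \<le> ennreal (norm (g w - s i w)) + ennreal (norm (s i w - c (nat \<lfloor>real N * w\<rfloor>)))"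
        by (simp flip: ennreal_plus)
    qed
    also have "\<dots> = (\<integral>\<^sup>+ w. norm (g w - s i w) \<partial>unit_measure) +
        (\<integral>\<^sup>+ w. norm (s i w - c (nat \<lfloor>real N * w\<rfloor>)) \<partial>unit_measure)"
      using meas_s measurable_norm_diff_simple[OF meas sf] by (intro nn_integral_add) auto
    also have "\<dots> < ennreal (\<epsilon> / 2) + ennreal (\<epsilon> / 2)"
      by (intro add_strict_mono i c)
    also have "\<dots> = ennreal \<epsilon>"
      using \<open>0 < \<epsilon>\<close> by (simp flip: ennreal_plus)
    finally have h: "(\<integral>\<^sup>+ w. ?h w \<partial>unit_measure) < ennreal \<epsilon>" .
    have "(\<Sum>l<N * K. norm (G (cell (N * K) l) - (1 / real (N * K)) *\<^sub>R c (l div K))) < \<epsilon>"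
      if "0 < K" for K
    proof -
      have NK: "0 < N * K" using \<open>0 < N\<close> \<open>0 < K\<close> by simp
      have le: "ennreal (norm (G (cell (N * K) l) - (1 / real (N * K)) *\<^sub>R c (l div K))) \<le>
          (\<integral>\<^sup>+ w. ennreal (?h w) * indicator (cell (N * K) l) w \<partial>unit_measure)" if l: "l < N * K" for l
      proof -
        have A: "cell (N * K) l \<in> sets unit_measure" "emeasure unit_measure (cell (N * K) l) < \<infinity>"
          by (auto simp: less_top[symmetric] simp del: emeasure_uniform_measure)
        have "ennreal (norm (G (cell (N * K) l) - (1 / real (N * K)) *\<^sub>R c (l div K))) \<le>
          (\<integral>\<^sup>+ w. norm (indicator (cell (N * K) l) w *\<^sub>R g w - indicator (cell (N * K) l) w *\<^sub>R c (l div K)) \<partial>unit_measure)"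
          using has_bochner_integral'_bound[OF int simple_bochner_integral_indicator(1)[OF A], of "cell (N * K) l" "c (l div K)"]
          unfolding simple_bochner_integral_indicator(2)[OF A] measure_cell[OF l] by simp
        also have "\<dots> = (\<integral>\<^sup>+ w. ennreal (?h w) * indicator (cell (N * K) l) w \<partial>unit_measure)"
        proof (rule nn_integral_cong)
          fix w
          have "nat \<lfloor>real N * w\<rfloor> = l div K" if "w \<in> cell (N * K) l"
            using cell_refine[OF that \<open>0 < K\<close>] by (simp add: cell_def)
          then show "ennreal (norm (indicator (cell (N * K) l) w *\<^sub>R g w - indicator (cell (N * K) l) w *\<^sub>R c (l div K))) =
              ennreal (?h w) * indicator (cell (N * K) l) w"
            by (auto split: split_indicator)
        qed
        finally show ?thesis .
      qed
      have "ennreal (\<Sum>l<N * K. norm (G (cell (N * K) l) - (1 / real (N * K)) *\<^sub>R c (l div K))) =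
          (\<Sum>l<N * K. ennreal (norm (G (cell (N * K) l) - (1 / real (N * K)) *\<^sub>R c (l div K))))"
        by (rule sum_ennreal[symmetric]) simp
      also have "\<dots> \<le> (\<Sum>l<N * K. \<integral>\<^sup>+ w. ennreal (?h w) * indicator (cell (N * K) l) w \<partial>unit_measure)"
        using le by (intro sum_mono) auto
      also have "\<dots> = (\<integral>\<^sup>+ w. (\<Sum>l<N * K. ennreal (?h w) * indicator (cell (N * K) l) w) \<partial>unit_measure)"
        using meas_h by (intro nn_integral_sum[symmetric]) (auto intro!: borel_measurable_times_ennreal)
      also have "\<dots> \<le> (\<integral>\<^sup>+ w. ?h w \<partial>unit_measure)"
      proof (rule nn_integral_mono)
        fix w
        have "(\<Sum>l<N * K. ennreal (?h w) * indicator (cell (N * K) l) w) =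
            (\<Sum>l<N * K. if \<lfloor>real (N * K) * w\<rfloor> = int l then ennreal (?h w) else 0)"
          by (intro sum.cong) (auto simp: cell_def)
        also have "\<dots> \<le> (\<Sum>l<N * K. if l = nat \<lfloor>real (N * K) * w\<rfloor> then ennreal (?h w) else 0)"
          by (intro sum_mono) auto
        also have "\<dots> \<le> ennreal (?h w)"
          by simp
        finally show "(\<Sum>l<N * K. ennreal (?h w) * indicator (cell (N * K) l) w) \<le> ennreal (?h w)" .
      qed
      also note h
      finally show ?thesis
        by (simp add: ennreal_less_iff sum_nonneg)
    qed
    then show ?case by blast
  qed
qed


section \<open>Quasi-martingales with large jumps\<close>

lemma sum_lessThan_mult:
  fixes h :: "nat \<Rightarrow> 'b::comm_monoid_add"
  shows "(\<Sum>l<M * k. h l) = (\<Sum>i<M. \<Sum>j<k. h (i * k + j))"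
proof -
  have "(\<Sum>l<M * k. h l) = (\<Sum>i<M. sum h {i * k..<i * k + k})"
    by (rule sum.nat_group[symmetric])
  also have "\<dots> = (\<Sum>i<M. \<Sum>j<k. h (i * k + j))"
  proof (rule sum.cong)
    fix i
    show "sum h {i * k..<i * k + k} = (\<Sum>j<k. h (i * k + j))"
      using sum.shift_bounds_nat_ivl[of h 0 "i * k" k] by (simp add: atLeast0LessThan add.commute)
  qed simp
  finally show ?thesis .
qed

text \<open>
  A tree of points of the unit ball. The points \<open>x n i\<close> with \<open>i < N n\<close> form level \<open>n\<close>; the children of
  \<open>x n i\<close> are the \<open>K n\<close> points \<open>x (n + 1) (i * K n + j)\<close>, all at distance at least \<open>\<epsilon>\<close> from it. The
  distances from the points of level \<open>n\<close> to the averages of their children have a summable mean. Giving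
  \<open>x n i\<close> the cell \<open>i\<close> of the subdivision of \<open>[0, 1)\<close> into \<open>N n\<close> cells turns each level into a step
  function, and the sequence of levels into a bounded quasi-martingale.
\<close>

locale quasi_martingale_tree =
  fixes N K :: "nat \<Rightarrow> nat" and x :: "nat \<Rightarrow> nat \<Rightarrow> 'a::banach" and \<epsilon> :: real
  assumes N_pos: "0 < N 0" and N_Suc: "N (Suc n) = N n * K n" and K_ge: "2 \<le> K n"
    and norm_le: "i < N n \<Longrightarrow> norm (x n i) \<le> 1"
    and far: "i < N n \<Longrightarrow> j < K n \<Longrightarrow> \<epsilon> \<le> norm (x (Suc n) (i * K n + j) - x n i)"
    and eps_pos: "0 < \<epsilon>"
    and summable_drift: "summable (\<lambda>n. (\<Sum>i<N n.
      norm ((1 / real (K n)) *\<^sub>R (\<Sum>j<K n. x (Suc n) (i * K n + j)) - x n i)) / real (N n))"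
begin

text \<open>
  The distance of a point from the average of its children.
\<close>

definition drift :: "nat \<Rightarrow> nat \<Rightarrow> real" where
  "drift n i = norm ((1 / real (K n)) *\<^sub>R (\<Sum>j<K n. x (Suc n) (i * K n + j)) - x n i)"

definition mean_drift :: "nat \<Rightarrow> real" where
  "mean_drift n = (\<Sum>i<N n. drift n i) / real (N n)"

text \<open>
  The integral over \<open>E\<close> of the step function given by level \<open>n\<close>.
\<close>

definition A :: "nat \<Rightarrow> real set \<Rightarrow> 'a" where
  "A n E = (\<Sum>i<N n. measure unit_measure (E \<inter> cell (N n) i) *\<^sub>R x n i)"

sublocale finite_measure unit_measure
  by (rule finite_unit_measure)

lemma K_pos: "0 < K n"
  using K_ge[of n] by simp

lemma N_gt_0: "0 < N n"
  by (induction n) (simp_all add: N_pos N_Suc K_pos)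

lemma filterlim_N: "filterlim N at_top sequentially"
proof -
  have "n \<le> N n" for n
  proof (induction n)
    case (Suc n)
    have "Suc n \<le> N n * 2" using Suc N_gt_0[of n] by simp
    also have "\<dots> \<le> N (Suc n)" using K_ge[of n] by (simp add: N_Suc)
    finally show ?case .
  qed simp
  then show ?thesis
    by (intro filterlim_at_top_mono[OF filterlim_ident] always_eventually) auto
qed

lemma N_dvd: "m \<le> n \<Longrightarrow> N m dvd N n"
  by (induction n rule: dec_induct) (simp_all add: N_Suc)

lemma summable_mean_drift: "summable mean_drift"
  using summable_drift unfolding mean_drift_def[abs_def] drift_def .

lemma mean_drift_nonneg: "0 \<le> mean_drift n"
  by (simp add: mean_drift_def drift_def sum_nonneg)

lemma sum_next: "(\<Sum>l<N (Suc n). h l) = (\<Sum>i<N n. \<Sum>j<K n. h (i * K n + j))"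
  for h :: "nat \<Rightarrow> 'b::comm_monoid_add"
  unfolding N_Suc by (rule sum_lessThan_mult)

lemma A_diff_le:
  assumes [measurable]: "E \<in> sets borel" "F \<in> sets borel"
  shows "norm (A n E - A n F) \<le> measure unit_measure (sym_diff E F)"
proof -
  have le: "\<bar>measure unit_measure (E \<inter> C) - measure unit_measure (F \<inter> C)\<bar> \<le>
      measure unit_measure (sym_diff E F \<inter> C)" if [measurable]: "C \<in> sets borel" for C
  proof -
    have "measure unit_measure (E \<inter> C) \<le> measure unit_measure ((F \<inter> C) \<union> (sym_diff E F \<inter> C))"
      "measure unit_measure (F \<inter> C) \<le> measure unit_measure ((E \<inter> C) \<union> (sym_diff E F \<inter> C))"
      by (intro finite_measure_mono; force)+
    moreover have "measure unit_measure ((F \<inter> C) \<union> (sym_diff E F \<inter> C)) \<le>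
        measure unit_measure (F \<inter> C) + measure unit_measure (sym_diff E F \<inter> C)"
      "measure unit_measure ((E \<inter> C) \<union> (sym_diff E F \<inter> C)) \<le>
        measure unit_measure (E \<inter> C) + measure unit_measure (sym_diff E F \<inter> C)"
      by (intro measure_Un_le; simp)+
    ultimately show ?thesis by linarith
  qed
  have "norm (A n E - A n F) = norm (\<Sum>i<N n.
      (measure unit_measure (E \<inter> cell (N n) i) - measure unit_measure (F \<inter> cell (N n) i)) *\<^sub>R x n i)"
    by (simp only: A_def sum_subtractf scaleR_diff_left)
  also have "\<dots> \<le> (\<Sum>i<N n. measure unit_measure (sym_diff E F \<inter> cell (N n) i))"
  proof (rule sum_norm_le)
    fix i assume "i \<in> {..<N n}"
    then have "\<bar>measure unit_measure (E \<inter> cell (N n) i) - measure unit_measure (F \<inter> cell (N n) i)\<bar> * norm (x n i)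
        \<le> measure unit_measure (sym_diff E F \<inter> cell (N n) i) * 1"
      by (intro mult_mono le norm_le) auto
    then show "norm ((measure unit_measure (E \<inter> cell (N n) i) - measure unit_measure (F \<inter> cell (N n) i)) *\<^sub>R x n i)
        \<le> measure unit_measure (sym_diff E F \<inter> cell (N n) i)"
      by (simp only: norm_scaleR mult_1_right)
  qed
  also have "\<dots> = measure unit_measure (sym_diff E F)"
    by (rule measure_eq_sum_cells[OF N_gt_0, symmetric]) simp
  finally show ?thesis .
qed

lemma A_empty: "A n {} = 0"
  by (simp add: A_def)

lemma A_UN:
  assumes "finite I" and E: "\<And>i. i \<in> I \<Longrightarrow> E i \<in> sets borel" and "disjoint_family_on E I"
  shows "A n (\<Union>i\<in>I. E i) = (\<Sum>i\<in>I. A n (E i))"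
proof -
  have "measure unit_measure ((\<Union>i\<in>I. E i) \<inter> C) = (\<Sum>i\<in>I. measure unit_measure (E i \<inter> C))"
    if [measurable]: "C \<in> sets borel" for C
  proof -
    have "measure unit_measure ((\<Union>i\<in>I. E i) \<inter> C) = measure unit_measure (\<Union>i\<in>I. E i \<inter> C)"
      by (simp only: Int_UN_distrib2 UN_simps)
    also have "\<dots> = (\<Sum>i\<in>I. measure unit_measure (E i \<inter> C))"
      using assms by (intro finite_measure_finite_Union) (auto simp: disjoint_family_on_def)
    finally show ?thesis .
  qed
  then have "A n (\<Union>i\<in>I. E i) = (\<Sum>l<N n. \<Sum>i\<in>I. measure unit_measure (E i \<inter> cell (N n) l) *\<^sub>R x n l)"
    unfolding A_def by (simp only: cell_borel scaleR_sum_left)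
  also have "\<dots> = (\<Sum>i\<in>I. A n (E i))"
    unfolding A_def by (rule sum.swap)
  finally show ?thesis .
qed

lemma A_cell: "i < N n \<Longrightarrow> A n (cell (N n) i) = (1 / real (N n)) *\<^sub>R x n i"
proof -
  assume i: "i < N n"
  have "A n (cell (N n) i) = (\<Sum>l<N n. if l = i then (1 / real (N n)) *\<^sub>R x n i else 0)"
    unfolding A_def
  proof (rule sum.cong)
    fix l assume "l \<in> {..<N n}"
    show "measure unit_measure (cell (N n) i \<inter> cell (N n) l) *\<^sub>R x n l =
        (if l = i then (1 / real (N n)) *\<^sub>R x n i else 0)"
      using cell_disjoint[of i l "N n"] measure_cell[OF i]
      by (cases "l = i") (simp_all only: Int_absorb measure_empty scaleR_zero_left simp_thms if_True if_False)
  qed simp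
  also have "\<dots> = (1 / real (N n)) *\<^sub>R x n i"
    using i by simp
  finally show ?thesis .
qed

text \<open>
  On a union \<open>E\<close> of cells of level \<open>n\<close>, passing to the next level replaces each value by the average of
  its children, so that the integral changes by no more than the integral of the drift.
\<close>

lemma A_step_le:
  assumes [measurable]: "E \<in> sets borel"
    and cells: "\<And>l. l < N n \<Longrightarrow> cell (N n) l \<subseteq> E \<or> E \<inter> cell (N n) l = {}"
  shows "norm (A (Suc n) E - A n E) \<le> (\<Sum>l<N n. measure unit_measure (E \<inter> cell (N n) l) * drift n l)"
proof -
  have child: "measure unit_measure (E \<inter> cell (N (Suc n)) (i * K n + j)) =
      measure unit_measure (E \<inter> cell (N n) i) / real (K n)" if i: "i < N n" and j: "j < K n" for i j
  proof -
    have sub: "cell (N (Suc n)) (i * K n + j) \<subseteq> cell (N n) i"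
      using cell_refine[of _ "N n" "K n" "i * K n + j"] K_pos j by (auto simp: N_Suc)
    have "i * K n + j < N (Suc n)"
    proof -
      have "i * K n + j < Suc i * K n" using j by simp
      also have "\<dots> \<le> N n * K n" using i by (intro mult_le_mono1) simp
      finally show ?thesis by (simp add: N_Suc)
    qed
    then have m: "measure unit_measure (cell (N (Suc n)) (i * K n + j)) = 1 / real (N (Suc n))"
      by (rule measure_cell)
    from cells[OF i] show ?thesis
    proof
      assume "cell (N n) i \<subseteq> E"
      with sub have "E \<inter> cell (N (Suc n)) (i * K n + j) = cell (N (Suc n)) (i * K n + j)"
        "E \<inter> cell (N n) i = cell (N n) i" by auto
      then show ?thesis using m measure_cell[OF i] by (simp only: N_Suc) simp
    next
      assume "E \<inter> cell (N n) i = {}"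
      moreover from this sub have "E \<inter> cell (N (Suc n)) (i * K n + j) = {}" by auto
      ultimately show ?thesis by simp
    qed
  qed
  have "A (Suc n) E = (\<Sum>i<N n. \<Sum>j<K n.
      (measure unit_measure (E \<inter> cell (N n) i) / real (K n)) *\<^sub>R x (Suc n) (i * K n + j))"
    unfolding A_def sum_next by (intro sum.cong refl) (simp only: child lessThan_iff)
  then have "A (Suc n) E - A n E = (\<Sum>i<N n. measure unit_measure (E \<inter> cell (N n) i) *\<^sub>R
      ((1 / real (K n)) *\<^sub>R (\<Sum>j<K n. x (Suc n) (i * K n + j)) - x n i))"
    by (simp add: A_def sum_subtractf scaleR_diff_right scaleR_sum_right del: measure_uniform_measure)
  also have "norm \<dots> \<le> (\<Sum>l<N n. measure unit_measure (E \<inter> cell (N n) l) * drift n l)"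
    by (intro sum_norm_le) (simp add: drift_def del: measure_uniform_measure)
  finally show ?thesis .
qed

lemma sum_cells_A_step_le:
  assumes "m \<le> n"
  shows "(\<Sum>i<N m. norm (A (Suc n) (cell (N m) i) - A n (cell (N m) i))) \<le> mean_drift n"
proof -
  obtain R where R: "N n = N m * R" using N_dvd[OF assms] by blast
  then have "0 < R" using N_gt_0[of n] by simp
  have nested: "cell (N n) l \<subseteq> cell (N m) i \<or> cell (N m) i \<inter> cell (N n) l = {}" for l i
    using cell_refine[of _ "N m" R l] \<open>0 < R\<close> cell_disjoint[of "l div R" i "N m"] unfolding R by blast
  have "(\<Sum>i<N m. norm (A (Suc n) (cell (N m) i) - A n (cell (N m) i))) \<le>
      (\<Sum>i<N m. \<Sum>l<N n. measure unit_measure (cell (N m) i \<inter> cell (N n) l) * drift n l)"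
    by (intro sum_mono A_step_le nested) simp
  also have "\<dots> = (\<Sum>l<N n. (\<Sum>i<N m. measure unit_measure (cell (N n) l \<inter> cell (N m) i)) * drift n l)"
    by (subst sum.swap) (simp only: sum_distrib_right Int_commute)
  also have "\<dots> = (\<Sum>l<N n. (1 / real (N n)) * drift n l)"
    by (intro sum.cong refl) (simp only: measure_eq_sum_cells[OF N_gt_0, symmetric] cell_borel measure_cell lessThan_iff)
  also have "\<dots> = mean_drift n"
    by (simp add: mean_drift_def sum_divide_distrib)
  finally show ?thesis .
qed

lemma A_cell_step_le:
  assumes "m \<le> n" "i < N m"
  shows "norm (A (Suc n) (cell (N m) i) - A n (cell (N m) i)) \<le> mean_drift n"
  using sum_cells_A_step_le[OF assms(1)] assms(2)
    member_le_sum[of i "{..<N m}" "\<lambda>i. norm (A (Suc n) (cell (N m) i) - A n (cell (N m) i))"]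
  by simp

lemma convergent_A_cell:
  assumes "i < N m"
  shows "convergent (\<lambda>n. A n (cell (N m) i))"
proof -
  let ?X = "\<lambda>n. A n (cell (N m) i)"
  have "summable (\<lambda>n. ?X (Suc n) - ?X n)"
    by (rule summable_comparison_test'[OF summable_mean_drift]) (rule A_cell_step_le[OF _ assms])
  moreover have "(\<Sum>k<n. ?X (Suc k) - ?X k) = ?X n - ?X 0" for n
    by (induction n) simp_all
  ultimately have "convergent (\<lambda>n. ?X n - ?X 0)"
    by (simp only: summable_iff_convergent)
  from convergent_add[OF this convergent_const[of "?X 0"]] show ?thesis by simp
qed

text \<open>
  On a single cell convergence follows from the summability of the drift; a general Borel set is
  approximated by unions of cells, uniformly in \<open>n\<close> because the step functions are bounded by 1.
\<close>

lemma convergent_A: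
  assumes E: "E \<in> sets borel"
  shows "convergent (\<lambda>n. A n E)"
proof (rule Cauchy_convergent, rule CauchyI)
  fix e :: real assume "0 < e"
  then have "\<forall>\<^sub>F M in sequentially. \<exists>S\<subseteq>{..<M}. measure unit_measure (sym_diff E (\<Union>i\<in>S. cell M i)) < e / 3"
    by (intro borel_approx_cells E) simp
  then have "\<forall>\<^sub>F m in sequentially. \<exists>S\<subseteq>{..<N m}. measure unit_measure (sym_diff E (\<Union>i\<in>S. cell (N m) i)) < e / 3"
    by (rule eventually_compose_filterlim[OF _ filterlim_N])
  then obtain m S where S: "S \<subseteq> {..<N m}"
    and less: "measure unit_measure (sym_diff E (\<Union>i\<in>S. cell (N m) i)) < e / 3"
    by (auto simp: eventually_sequentially simp del: measure_uniform_measure)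
  define F where "F = (\<Union>i\<in>S. cell (N m) i)"
  have "finite S" using S finite_subset by blast
  then have F: "F \<in> sets borel" by (auto simp: F_def)
  have "A n F = (\<Sum>i\<in>S. A n (cell (N m) i))" for n
    unfolding F_def by (intro A_UN \<open>finite S\<close>) (auto simp: disjoint_family_on_def cell_disjoint)
  moreover have "convergent (\<lambda>n. \<Sum>i\<in>S. A n (cell (N m) i))"
    using S by (intro convergent_sum convergent_A_cell) auto
  ultimately have "Cauchy (\<lambda>n. A n F)"
    by (simp add: convergent_Cauchy)
  from CauchyD[OF this, of "e / 3"] \<open>0 < e\<close> obtain M
    where M: "\<And>k n. M \<le> k \<Longrightarrow> M \<le> n \<Longrightarrow> norm (A k F - A n F) < e / 3" by auto
  have close: "norm (A n E - A n F) < e / 3" for n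
    using A_diff_le[OF E F, of n] less unfolding F_def by (rule order_le_less_trans)
  have "norm (A k E - A n E) < e" if "M \<le> k" "M \<le> n" for k n
  proof -
    have "A k E - A n E = (A k E - A k F) + (A k F - A n F) - (A n E - A n F)" by simp
    then have "norm (A k E - A n E) \<le> norm (A k E - A k F) + norm (A k F - A n F) + norm (A n E - A n F)"
      using norm_triangle_ineq4[of "(A k E - A k F) + (A k F - A n F)" "A n E - A n F"]
        norm_triangle_ineq[of "A k E - A k F" "A k F - A n F"] by simp
    then show ?thesis using close[of k] close[of n] M[OF that] by simp
  qed
  then show "\<exists>M. \<forall>k\<ge>M. \<forall>n\<ge>M. norm (A k E - A n E) < e" by blast
qed

text \<open>
  The limit of the integrals over \<open>E\<close>, which is the vector measure without a density.
\<close>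

definition G :: "real set \<Rightarrow> 'a" where
  "G E = lim (\<lambda>n. A n E)"

lemma A_tendsto_G: "E \<in> sets borel \<Longrightarrow> (\<lambda>n. A n E) \<longlonglongrightarrow> G E"
  unfolding G_def using convergent_A convergent_LIMSEQ_iff by blast

lemma G_diff_le:
  assumes "E \<in> sets borel" "F \<in> sets borel"
  shows "norm (G E - G F) \<le> measure unit_measure (sym_diff E F)"
  by (rule LIMSEQ_le_const2[OF tendsto_norm[OF tendsto_diff[OF A_tendsto_G A_tendsto_G]]])
    (use assms A_diff_le in auto)

lemma G_empty: "G {} = 0"
  unfolding G_def by (simp add: A_empty lim_const)

lemma norm_G_le: "E \<in> sets borel \<Longrightarrow> norm (G E) \<le> measure unit_measure E"
  using G_diff_le[of E "{}"] by (simp add: G_empty del: measure_uniform_measure)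

lemma G_UN:
  assumes "finite I" and "\<And>i. i \<in> I \<Longrightarrow> E i \<in> sets borel" and "disjoint_family_on E I"
  shows "G (\<Union>i\<in>I. E i) = (\<Sum>i\<in>I. G (E i))"
proof (rule LIMSEQ_unique)
  show "(\<lambda>n. A n (\<Union>i\<in>I. E i)) \<longlonglongrightarrow> G (\<Union>i\<in>I. E i)"
    using assms by (intro A_tendsto_G) auto
  show "(\<lambda>n. A n (\<Union>i\<in>I. E i)) \<longlonglongrightarrow> (\<Sum>i\<in>I. G (E i))"
    by (simp only: A_UN[OF assms]) (intro tendsto_sum A_tendsto_G assms(2))
qed

lemma vector_measure_G: "vector_measure unit_measure G"
  unfolding vector_measure_def
proof (intro allI impI)
  fix E :: "nat \<Rightarrow> real set"
  assume "range E \<subseteq> sets unit_measure" and disj: "disjoint_family E"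
  then have E[measurable]: "E n \<in> sets borel" for n by auto
  have "(\<lambda>k. measure unit_measure (\<Union>n<k. E n)) \<longlonglongrightarrow> measure unit_measure (\<Union>k. \<Union>n<k. E n)"
    by (intro finite_Lim_measure_incseq) (auto simp: incseq_def intro: less_le_trans)
  moreover have "(\<Union>k. \<Union>n<k. E n) = (\<Union>n. E n)" by auto
  ultimately have "(\<lambda>k. measure unit_measure (\<Union>n<k. E n)) \<longlonglongrightarrow> measure unit_measure (\<Union>n. E n)"
    by (simp only:)
  from tendsto_diff[OF tendsto_const this, of "measure unit_measure (\<Union>n. E n)"]
  have "(\<lambda>k. measure unit_measure (\<Union>n. E n) - measure unit_measure (\<Union>n<k. E n)) \<longlonglongrightarrow> 0"
    by (simp only: diff_self)
  then have "(\<lambda>k. (\<Sum>n<k. G (E n)) - G (\<Union>n. E n)) \<longlonglongrightarrow> 0"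
  proof (rule Lim_null_comparison[rotated], intro always_eventually allI)
    fix k
    have "(\<Sum>n<k. G (E n)) = G (\<Union>n<k. E n)"
      using disj by (intro G_UN[symmetric]) (auto simp: disjoint_family_on_def)
    then have "norm ((\<Sum>n<k. G (E n)) - G (\<Union>n. E n)) = norm (G (\<Union>n. E n) - G (\<Union>n<k. E n))"
      by (simp add: norm_minus_commute)
    also have "\<dots> \<le> measure unit_measure (sym_diff (\<Union>n. E n) (\<Union>n<k. E n))"
      by (intro G_diff_le) auto
    also have "sym_diff (\<Union>n. E n) (\<Union>n<k. E n) = (\<Union>n. E n) - (\<Union>n<k. E n)" by auto
    also have "measure unit_measure \<dots> = measure unit_measure (\<Union>n. E n) - measure unit_measure (\<Union>n<k. E n)"
      by (intro finite_measure_Diff) auto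
    finally show "norm ((\<Sum>n<k. G (E n)) - G (\<Union>n. E n)) \<le>
        measure unit_measure (\<Union>n. E n) - measure unit_measure (\<Union>n<k. E n)" .
  qed
  then show "(\<lambda>n. G (E n)) sums G (\<Union>n. E n)"
    unfolding sums_def by (rule LIM_zero_cancel)
qed

lemma bounded_variation_G: "bounded_variation unit_measure G"
  unfolding bounded_variation_def
proof (intro exI[of _ 1] allI impI)
  fix P assume P: "finite P" "P \<subseteq> sets unit_measure" "partition_on (space unit_measure) P"
  have "(\<Sum>E\<in>P. norm (G E)) \<le> (\<Sum>E\<in>P. measure unit_measure E)"
    using P(2) by (intro sum_mono norm_G_le) auto
  also have "\<dots> = measure unit_measure (\<Union>E\<in>P. E)"
    using P by (intro finite_measure_finite_Union[symmetric])
      (auto simp: partition_on_def disjoint_family_on_def disjoint_def)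
  also have "\<dots> = measure unit_measure UNIV"
    using P(3) by (simp add: partition_on_def del: measure_uniform_measure)
  also note finite_unit_measure(2)
  finally show "(\<Sum>E\<in>P. norm (G E)) \<le> 1" by simp
qed

lemma vanishes_on_null_sets_G: "vanishes_on_null_sets unit_measure G"
  unfolding vanishes_on_null_sets_def
proof
  fix E assume "E \<in> null_sets unit_measure"
  then have "E \<in> sets borel" "measure unit_measure E = 0"
    by (auto simp: null_sets_def measure_def simp del: measure_uniform_measure)
  with norm_G_le[of E] show "G E = 0" by simp
qed

lemma sum_cells_A_diff_le:
  assumes "m \<le> n"
  shows "(\<Sum>i<N m. norm (A n (cell (N m) i) - A m (cell (N m) i))) \<le> (\<Sum>k=m..<n. mean_drift k)"
  using assms
proof (induction n rule: dec_induct)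
  case (step n)
  have "(\<Sum>i<N m. norm (A (Suc n) (cell (N m) i) - A m (cell (N m) i))) \<le>
      (\<Sum>i<N m. norm (A (Suc n) (cell (N m) i) - A n (cell (N m) i)) +
        norm (A n (cell (N m) i) - A m (cell (N m) i)))"
    by (intro sum_mono) (metis norm_diff_triangle_le order_refl)
  also have "\<dots> \<le> mean_drift n + (\<Sum>k=m..<n. mean_drift k)"
    unfolding sum.distrib using sum_cells_A_step_le step by (intro add_mono) auto
  finally show ?case using step.hyps by (simp add: add.commute)
qed simp

lemma sum_cells_G_diff_le:
  "(\<Sum>i<N m. norm (G (cell (N m) i) - (1 / real (N m)) *\<^sub>R x m i)) \<le> (\<Sum>k. mean_drift (k + m))"
proof -
  have "(\<lambda>n. \<Sum>i<N m. norm (A n (cell (N m) i) - A m (cell (N m) i))) \<longlonglongrightarrow>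
      (\<Sum>i<N m. norm (G (cell (N m) i) - A m (cell (N m) i)))"
    by (intro tendsto_intros A_tendsto_G) simp
  moreover have "(\<Sum>i<N m. norm (A n (cell (N m) i) - A m (cell (N m) i))) \<le> (\<Sum>k. mean_drift (k + m))"
    if "m \<le> n" for n
  proof -
    have "(\<Sum>k=m..<n. mean_drift k) = (\<Sum>k<n - m. mean_drift (k + m))"
      using sum.shift_bounds_nat_ivl[of mean_drift 0 m "n - m"] that by (simp add: atLeast0LessThan)
    also have "\<dots> \<le> (\<Sum>k. mean_drift (k + m))"
      using summable_mean_drift by (intro sum_le_suminf) (auto simp: mean_drift_nonneg summable_iff_shift)
    finally show ?thesis using sum_cells_A_diff_le[OF that] by simp
  qed
  ultimately have "(\<Sum>i<N m. norm (G (cell (N m) i) - A m (cell (N m) i))) \<le> (\<Sum>k. mean_drift (k + m))"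
    by (intro LIMSEQ_le_const2) auto
  then show ?thesis by (simp add: A_cell)
qed

text \<open>
  A density of \<open>G\<close> would give constants \<open>c i\<close> on the cells of some level \<open>n\<close> from which both level \<open>n\<close> and
  level \<open>n + 1\<close> differ by less than \<open>\<epsilon> / 4\<close> in mean. Then the two levels differ by less than \<open>\<epsilon> / 2\<close> in
  mean, although the jumps are at least \<open>\<epsilon>\<close>.
\<close>

theorem not_radon_nikodym: "\<not> radon_nikodym_property TYPE('a)"
proof
  assume "radon_nikodym_property TYPE('a)"
  then have "radon_nikodym_wrt unit_measure TYPE('a)"
    unfolding radon_nikodym_property_def using finite_unit_measure(1) by blast
  then obtain g where g: "\<And>E. E \<in> sets borel \<Longrightarrow>
      has_bochner_integral' unit_measure (\<lambda>w. indicator E w *\<^sub>R g w) (G E)"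
    unfolding radon_nikodym_wrt_def
    using vector_measure_G bounded_variation_G vanishes_on_null_sets_G by fastforce
  have "0 < \<epsilon> / 8" using eps_pos by simp
  from derivative_approx_cells[OF g this]
  have "\<forall>\<^sub>F M in sequentially. \<exists>c. \<forall>R>0.
    (\<Sum>l<M * R. norm (G (cell (M * R) l) - (1 / real (M * R)) *\<^sub>R c (l div R))) < \<epsilon> / 8" .
  then have "\<forall>\<^sub>F n in sequentially. \<exists>c. \<forall>R>0.
    (\<Sum>l<N n * R. norm (G (cell (N n * R) l) - (1 / real (N n * R)) *\<^sub>R c (l div R))) < \<epsilon> / 8"
    by (rule eventually_compose_filterlim[OF _ filterlim_N])
  then obtain n0 where n0: "\<And>n. n0 \<le> n \<Longrightarrow> \<exists>c. \<forall>R>0.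
    (\<Sum>l<N n * R. norm (G (cell (N n * R) l) - (1 / real (N n * R)) *\<^sub>R c (l div R))) < \<epsilon> / 8"
    by (auto simp: eventually_sequentially)
  obtain n1 where n1: "\<And>n. n1 \<le> n \<Longrightarrow> norm (\<Sum>k. mean_drift (k + n)) < \<epsilon> / 8"
    using suminf_exist_split[OF \<open>0 < \<epsilon> / 8\<close> summable_mean_drift] by blast
  define n where "n = max n0 n1"
  have tail: "(\<Sum>k. mean_drift (k + n)) < \<epsilon> / 8" "(\<Sum>k. mean_drift (k + Suc n)) < \<epsilon> / 8"
  proof -
    have "n1 \<le> n" "n1 \<le> Suc n" by (auto simp: n_def)
    from n1[OF this(1)] n1[OF this(2)]
    show "(\<Sum>k. mean_drift (k + n)) < \<epsilon> / 8" "(\<Sum>k. mean_drift (k + Suc n)) < \<epsilon> / 8"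
      by (simp_all only: real_norm_def abs_less_iff)
  qed
  obtain c where c: "\<And>R. 0 < R \<Longrightarrow>
      (\<Sum>l<N n * R. norm (G (cell (N n * R) l) - (1 / real (N n * R)) *\<^sub>R c (l div R))) < \<epsilon> / 8"
    using n0[of n] unfolding n_def by auto
  \<comment> \<open>Used with \<open>k = n\<close> and with \<open>k = n + 1\<close>; one error of \<open>\<epsilon> / 8\<close> is the remaining drift, the other comes from \<open>c\<close>.\<close>
  have close: "(\<Sum>l<N k. norm (x k l - b l)) / real (N k) < \<epsilon> / 4"
    if b: "(\<Sum>l<N k. norm (G (cell (N k) l) - (1 / real (N k)) *\<^sub>R b l)) < \<epsilon> / 8"
      and t: "(\<Sum>j. mean_drift (j + k)) < \<epsilon> / 8" for k b
  proof -
    have "norm (x k l - b l) / real (N k) \<le> norm (G (cell (N k) l) - (1 / real (N k)) *\<^sub>R x k l) +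
        norm (G (cell (N k) l) - (1 / real (N k)) *\<^sub>R b l)" for l
    proof -
      have "norm (x k l - b l) / real (N k) = norm ((1 / real (N k)) *\<^sub>R x k l - (1 / real (N k)) *\<^sub>R b l)"
        by (simp flip: scaleR_diff_right)
      also have "\<dots> \<le> norm ((1 / real (N k)) *\<^sub>R x k l - G (cell (N k) l)) +
          norm (G (cell (N k) l) - (1 / real (N k)) *\<^sub>R b l)"
        by (metis norm_diff_triangle_le order_refl)
      finally show ?thesis by (simp add: norm_minus_commute)
    qed
    then have "(\<Sum>l<N k. norm (x k l - b l)) / real (N k) \<le>
        (\<Sum>l<N k. norm (G (cell (N k) l) - (1 / real (N k)) *\<^sub>R x k l) +
          norm (G (cell (N k) l) - (1 / real (N k)) *\<^sub>R b l))"
      unfolding sum_divide_distrib by (intro sum_mono)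
    then show ?thesis
      using sum_cells_G_diff_le[of k] b t unfolding sum.distrib by linarith
  qed
  have 1: "(\<Sum>i<N n. norm (x n i - c i)) / real (N n) < \<epsilon> / 4"
    using c[of 1] tail(1) by (intro close) simp_all
  have 2: "(\<Sum>l<N (Suc n). norm (x (Suc n) l - c (l div K n))) / real (N (Suc n)) < \<epsilon> / 4"
    using c[OF K_pos[of n], folded N_Suc] tail(2) by (rule close)
  have "real (N (Suc n)) * \<epsilon> = (\<Sum>i<N n. \<Sum>j<K n. \<epsilon>)"
    by (simp add: N_Suc)
  also have "\<dots> \<le> (\<Sum>i<N n. \<Sum>j<K n. norm (x (Suc n) (i * K n + j) - c i) + norm (x n i - c i))"
  proof (intro sum_mono)
    fix i j assume "i \<in> {..<N n}" "j \<in> {..<K n}"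
    then have "\<epsilon> \<le> norm (x (Suc n) (i * K n + j) - x n i)" by (intro far) auto
    also have "\<dots> \<le> norm (x (Suc n) (i * K n + j) - c i) + norm (c i - x n i)"
      by (metis norm_diff_triangle_le order_refl)
    finally show "\<epsilon> \<le> norm (x (Suc n) (i * K n + j) - c i) + norm (x n i - c i)"
      by (simp add: norm_minus_commute)
  qed
  also have "\<dots> = (\<Sum>l<N (Suc n). norm (x (Suc n) l - c (l div K n))) + real (K n) * (\<Sum>i<N n. norm (x n i - c i))"
    unfolding sum_next sum.distrib by (simp add: sum_distrib_left)
  also have "\<dots> < real (N (Suc n)) * (\<epsilon> / 4) + real (K n) * (real (N n) * (\<epsilon> / 4))"
  proof (intro add_strict_mono mult_strict_left_mono)
    show "(\<Sum>l<N (Suc n). norm (x (Suc n) l - c (l div K n))) < real (N (Suc n)) * (\<epsilon> / 4)"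
      using 2 N_gt_0[of "Suc n"] by (simp add: field_simps)
    show "(\<Sum>i<N n. norm (x n i - c i)) < real (N n) * (\<epsilon> / 4)"
      using 1 N_gt_0[of n] by (simp add: field_simps)
  qed (simp add: K_pos)
  also have "\<dots> = real (N (Suc n)) * (\<epsilon> / 2)"
    by (simp add: N_Suc)
  finally show False
    using eps_pos N_gt_0[of "Suc n"] by simp
qed

end


section \<open>Small slices and strong maxima\<close>

text \<open>
  Without small slices, the averages of \<open>no_small_slice_imp_averages\<close> can be iterated. With the error
  \<open>(1 / 2) ^ n\<close> at level \<open>n\<close>, the mean \<open>\<Phi> n\<close> of \<open>\<phi>\<close> over level \<open>n\<close> satisfies
  \<open>\<eta> * mean drift \<le> \<Phi> (n + 1) - \<Phi> n + (1 / 2) ^ n\<close>; as \<open>\<Phi>\<close> is bounded above, the drift is summable.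
\<close>

theorem exists_small_slice:
  fixes \<phi> :: "'a::banach \<Rightarrow> real"
  assumes rnp: "radon_nikodym_property TYPE('a)"
    and bdd: "\<And>z. z \<in> cball 0 1 \<Longrightarrow> \<phi> z \<le> C" and \<eta>: "0 < \<eta>" and \<epsilon>: "0 < \<epsilon>"
  shows "\<exists>f :: 'a \<Rightarrow>\<^sub>L real. norm f \<le> \<eta> \<and> (\<exists>x\<in>cball 0 1. \<exists>\<delta>>0. \<forall>z\<in>cball 0 1.
    \<phi> x + blinfun_apply f x - \<delta> < \<phi> z + blinfun_apply f z \<longrightarrow> norm (z - x) < \<epsilon>)"
proof (rule ccontr)
  assume neg: "\<not> ?thesis"
  have averages: "\<forall>\<^sub>F k in sequentially. \<exists>z. (\<forall>j<k. z j \<in> cball 0 1 \<and> \<epsilon> \<le> norm (z j - x)) \<and>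
      \<eta> * norm (\<Sum>j<k. z j - x) \<le> (\<Sum>j<k. \<phi> (z j) - \<phi> x + \<delta>)"
    if "x \<in> cball 0 1" "0 < \<delta>" for x \<delta>
  proof (rule no_small_slice_imp_averages)
    show "0 \<le> \<eta>" using \<eta> by simp
    show "\<exists>z\<in>cball 0 1. \<epsilon> \<le> norm (z - x) \<and> \<phi> x + blinfun_apply f x - \<delta> < \<phi> z + blinfun_apply f z"
      if "norm f \<le> \<eta>" for f :: "'a \<Rightarrow>\<^sub>L real"
      using neg that \<open>x \<in> cball 0 1\<close> \<open>0 < \<delta>\<close> not_less by metis
  qed
  \<comment> \<open>A level is stored as the pair of its number of points and the points; \<open>Q\<close> relates it to the next level.\<close>
  define P :: "nat \<Rightarrow> nat \<times> (nat \<Rightarrow> 'a) \<Rightarrow> bool"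
    where "P n s \<longleftrightarrow> 0 < fst s \<and> (\<forall>i<fst s. snd s i \<in> cball 0 1)" for n s
  define Q :: "nat \<Rightarrow> nat \<times> (nat \<Rightarrow> 'a) \<Rightarrow> nat \<times> (nat \<Rightarrow> 'a) \<Rightarrow> bool"
    where "Q n s s' \<longleftrightarrow> (\<exists>k\<ge>2. fst s' = fst s * k \<and> (\<forall>i<fst s.
      (\<forall>j<k. \<epsilon> \<le> norm (snd s' (i * k + j) - snd s i)) \<and>
      \<eta> * norm (\<Sum>j<k. snd s' (i * k + j) - snd s i) \<le>
        (\<Sum>j<k. \<phi> (snd s' (i * k + j)) - \<phi> (snd s i) + (1 / 2) ^ n)))" for n s s'
  have "\<exists>t. \<forall>n. P n (t n) \<and> Q n (t n) (t (Suc n))"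
  proof (rule dependent_nat_choice)
    show "\<exists>s. P 0 s" by (rule exI[of _ "(1, \<lambda>_. 0)"]) (simp add: P_def)
    fix s :: "nat \<times> (nat \<Rightarrow> 'a)" and n
    assume P: "P n s"
    obtain M x where s: "s = (M, x)" by (cases s)
    have "\<forall>\<^sub>F k in sequentially. \<forall>i\<in>{..<M}. \<exists>z. (\<forall>j<k. z j \<in> cball 0 1 \<and> \<epsilon> \<le> norm (z j - x i)) \<and>
      \<eta> * norm (\<Sum>j<k. z j - x i) \<le> (\<Sum>j<k. \<phi> (z j) - \<phi> (x i) + (1 / 2) ^ n)"
      using P by (intro eventually_ball_finite ballI averages) (auto simp: P_def s)
    then have "\<forall>\<^sub>F k in sequentially. 2 \<le> k \<and> (\<forall>i\<in>{..<M}. \<exists>z. (\<forall>j<k. z j \<in> cball 0 1 \<and> \<epsilon> \<le> norm (z j - x i)) \<and>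
      \<eta> * norm (\<Sum>j<k. z j - x i) \<le> (\<Sum>j<k. \<phi> (z j) - \<phi> (x i) + (1 / 2) ^ n))"
      by (intro eventually_conj eventually_ge_at_top)
    then obtain k :: nat where k: "2 \<le> k" and "\<forall>i\<in>{..<M}. \<exists>z. (\<forall>j<k. z j \<in> cball 0 1 \<and> \<epsilon> \<le> norm (z j - x i)) \<and>
      \<eta> * norm (\<Sum>j<k. z j - x i) \<le> (\<Sum>j<k. \<phi> (z j) - \<phi> (x i) + (1 / 2) ^ n)"
      unfolding eventually_sequentially by blast
    from bchoice[OF this(2)] obtain z where z: "\<And>i. i < M \<Longrightarrow> (\<forall>j<k. z i j \<in> cball 0 1 \<and> \<epsilon> \<le> norm (z i j - x i)) \<and>
      \<eta> * norm (\<Sum>j<k. z i j - x i) \<le> (\<Sum>j<k. \<phi> (z i j) - \<phi> (x i) + (1 / 2) ^ n)"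
      by blast
    define y where "y l = z (l div k) (l mod k)" for l
    have y: "y (i * k + j) = z i j" if "j < k" for i j
      using that by (simp add: y_def)
    have "P (Suc n) (M * k, y)"
    proof -
      have "y l \<in> cball 0 1" if "l < M * k" for l
      proof -
        have "l div k < M" using that by (simp add: less_mult_imp_div_less)
        moreover have "l mod k < k" using k by simp
        ultimately show ?thesis using z unfolding y_def by blast
      qed
      with P k show ?thesis by (auto simp: P_def s)
    qed
    moreover have "Q n s (M * k, y)"
      unfolding Q_def s using k z by (intro exI[of _ k]) (auto simp: y cong: sum.cong_simp)
    ultimately show "\<exists>s'. P (Suc n) s' \<and> Q n s s'" by blast
  qed
  then obtain t where t: "\<And>n. P n (t n)" "\<And>n. Q n (t n) (t (Suc n))" by blast
  define N where "N n = fst (t n)" for n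
  define x where "x n = snd (t n)" for n
  have "\<exists>K. \<forall>n. 2 \<le> K n \<and> N (Suc n) = N n * K n \<and> (\<forall>i<N n.
      (\<forall>j<K n. \<epsilon> \<le> norm (x (Suc n) (i * K n + j) - x n i)) \<and>
      \<eta> * norm (\<Sum>j<K n. x (Suc n) (i * K n + j) - x n i) \<le>
        (\<Sum>j<K n. \<phi> (x (Suc n) (i * K n + j)) - \<phi> (x n i) + (1 / 2) ^ n))"
    using t(2) unfolding Q_def N_def x_def by (intro choice) auto
  then obtain K where K: "\<And>n. 2 \<le> K n" "\<And>n. N (Suc n) = N n * K n"
      "\<And>n i j. i < N n \<Longrightarrow> j < K n \<Longrightarrow> \<epsilon> \<le> norm (x (Suc n) (i * K n + j) - x n i)"
    and gain: "\<And>n i. i < N n \<Longrightarrow> \<eta> * norm (\<Sum>j<K n. x (Suc n) (i * K n + j) - x n i) \<le>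
        (\<Sum>j<K n. \<phi> (x (Suc n) (i * K n + j)) - \<phi> (x n i) + (1 / 2) ^ n)"
    by blast
  have N: "0 < N n" and ball: "i < N n \<Longrightarrow> x n i \<in> cball 0 1" for n i
    using t(1)[of n] by (auto simp: P_def N_def x_def)
  define d where "d n i = norm ((1 / real (K n)) *\<^sub>R (\<Sum>j<K n. x (Suc n) (i * K n + j)) - x n i)" for n i
  define \<Phi> where "\<Phi> n = (\<Sum>i<N n. \<phi> (x n i)) / real (N n)" for n
  have \<Phi>_le: "\<Phi> n \<le> C" for n
  proof -
    have "(\<Sum>i<N n. \<phi> (x n i)) \<le> (\<Sum>i<N n. C)"
      using ball by (intro sum_mono bdd) simp
    then show ?thesis using N[of n] by (simp add: \<Phi>_def field_simps)
  qed
  have drift_le: "\<eta> * ((\<Sum>i<N n. d n i) / real (N n)) \<le> \<Phi> (Suc n) - \<Phi> n + (1 / 2) ^ n" for n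
  proof -
    have Kpos: "0 < real (K n)" using K(1)[of n] by linarith
    have "\<eta> * d n i \<le> (\<Sum>j<K n. \<phi> (x (Suc n) (i * K n + j))) / real (K n) - \<phi> (x n i) + (1 / 2) ^ n"
      if i: "i < N n" for i
    proof -
      have "(1 / real (K n)) *\<^sub>R (\<Sum>j<K n. x (Suc n) (i * K n + j) - x n i) =
          (1 / real (K n)) *\<^sub>R (\<Sum>j<K n. x (Suc n) (i * K n + j)) - x n i"
        using Kpos by (simp add: sum_subtractf scaleR_diff_right sum_constant_scaleR)
      then have "d n i = norm (\<Sum>j<K n. x (Suc n) (i * K n + j) - x n i) / real (K n)"
        using Kpos unfolding d_def by (metis abs_of_pos divide_pos_pos norm_scaleR mult_1 times_divide_eq_left zero_less_one)
      moreover have "(\<Sum>j<K n. \<phi> (x (Suc n) (i * K n + j)) - \<phi> (x n i) + (1 / 2) ^ n) =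
          (\<Sum>j<K n. \<phi> (x (Suc n) (i * K n + j))) - real (K n) * \<phi> (x n i) + real (K n) * (1 / 2) ^ n"
        by (simp only: sum.distrib sum_subtractf sum_constant card_lessThan)
      ultimately have "\<eta> * (real (K n) * d n i) \<le>
          (\<Sum>j<K n. \<phi> (x (Suc n) (i * K n + j))) - real (K n) * \<phi> (x n i) + real (K n) * (1 / 2) ^ n"
        using gain[OF i] Kpos by simp
      then have "real (K n) * (\<eta> * d n i) \<le>
          real (K n) * ((\<Sum>j<K n. \<phi> (x (Suc n) (i * K n + j))) / real (K n) - \<phi> (x n i) + (1 / 2) ^ n)"
        using Kpos by (simp add: distrib_left right_diff_distrib mult.left_commute)
      then show ?thesis
        using Kpos by (simp only: mult_le_cancel_left_pos)
    qed
    then have "\<eta> * (\<Sum>i<N n. d n i) \<le>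
        (\<Sum>i<N n. (\<Sum>j<K n. \<phi> (x (Suc n) (i * K n + j))) / real (K n) - \<phi> (x n i) + (1 / 2) ^ n)"
      unfolding sum_distrib_left by (intro sum_mono) simp
    also have "\<dots> = (\<Sum>l<N (Suc n). \<phi> (x (Suc n) l)) / real (K n) - (\<Sum>i<N n. \<phi> (x n i)) + real (N n) * (1 / 2) ^ n"
      unfolding K(2) sum_lessThan_mult
      by (simp only: sum.distrib sum_subtractf sum_constant card_lessThan sum_divide_distrib)
    finally have "\<eta> * (\<Sum>i<N n. d n i) / real (N n) \<le>
        ((\<Sum>l<N (Suc n). \<phi> (x (Suc n) l)) / real (K n) - (\<Sum>i<N n. \<phi> (x n i)) + real (N n) * (1 / 2) ^ n) / real (N n)"
      by (intro divide_right_mono) auto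
    also have "\<dots> = \<Phi> (Suc n) - \<Phi> n + (1 / 2) ^ n"
      using N[of n] by (simp add: \<Phi>_def K(2) add_divide_distrib diff_divide_distrib mult.commute)
    finally show ?thesis by simp
  qed
  have "summable (\<lambda>n. (\<Sum>i<N n. d n i) / real (N n))"
  proof (rule summableI_nonneg_bounded)
    show "0 \<le> (\<Sum>i<N n. d n i) / real (N n)" for n
      by (simp add: d_def sum_nonneg)
    fix m
    have "\<eta> * (\<Sum>n<m. (\<Sum>i<N n. d n i) / real (N n)) \<le> (\<Sum>n<m. \<Phi> (Suc n) - \<Phi> n + (1 / 2) ^ n)"
      unfolding sum_distrib_left by (intro sum_mono drift_le)
    also have "\<dots> = \<Phi> m - \<Phi> 0 + (\<Sum>n<m. (1 / 2) ^ n)"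
      by (simp only: sum.distrib sum_lessThan_telescope)
    also have "(\<Sum>n<m. (1 / 2) ^ n) \<le> (2 :: real)"
      by (simp add: sum_gp_strict)
    also have "\<Phi> m \<le> C" by (rule \<Phi>_le)
    finally have "\<eta> * (\<Sum>n<m. (\<Sum>i<N n. d n i) / real (N n)) \<le> C - \<Phi> 0 + 2" by simp
    then show "(\<Sum>n<m. (\<Sum>i<N n. d n i) / real (N n)) \<le> (C - \<Phi> 0 + 2) / \<eta>"
      using \<eta> by (simp add: field_simps)
  qed
  then interpret quasi_martingale_tree N K x \<epsilon>
    using K N ball \<epsilon> by unfold_locales (auto simp: d_def)
  show False using not_radon_nikodym rnp by blast
qed


text \<open>
  The function \<open>\<phi> + f\<close> has, over the closed unit ball, a slice of small diameter: all points where it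
  exceeds its value at \<open>x\<close> minus \<open>\<delta>\<close> are within \<open>\<epsilon>\<close> of \<open>x\<close>. The point \<open>x\<close> itself need not be a maximizer.
\<close>

definition small_slice :: "('a::real_normed_vector \<Rightarrow> real) \<Rightarrow> real \<Rightarrow> ('a \<Rightarrow>\<^sub>L real) \<Rightarrow> bool" where
  "small_slice \<phi> \<epsilon> f \<longleftrightarrow> (\<exists>x\<in>cball 0 1. \<exists>\<delta>>0. \<forall>z\<in>cball 0 1.
    \<phi> x + blinfun_apply f x - \<delta> < \<phi> z + blinfun_apply f z \<longrightarrow> norm (z - x) < \<epsilon>)"

lemma open_small_slice: "open {f. small_slice \<phi> \<epsilon> f}"
  unfolding open_dist
proof (intro ballI)
  fix f assume "f \<in> {f. small_slice \<phi> \<epsilon> f}"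
  then obtain x \<delta> where x: "x \<in> cball 0 1" "0 < \<delta>"
    and slice: "\<And>z. z \<in> cball 0 1 \<Longrightarrow>
      \<phi> x + blinfun_apply f x - \<delta> < \<phi> z + blinfun_apply f z \<Longrightarrow> norm (z - x) < \<epsilon>"
    unfolding small_slice_def by blast
  have "small_slice \<phi> \<epsilon> g" if "dist g f < \<delta> / 4" for g
    unfolding small_slice_def
  proof (intro bexI[OF _ x(1)] exI[of _ "\<delta> / 2"] conjI ballI impI)
    show "0 < \<delta> / 2" using x by simp
    have diff: "\<bar>blinfun_apply g z - blinfun_apply f z\<bar> \<le> \<delta> / 4" if "z \<in> cball 0 1" for z
    proof -
      have "\<bar>blinfun_apply g z - blinfun_apply f z\<bar> \<le> norm (g - f) * norm z"
        using norm_blinfun[of "g - f" z] by (simp add: blinfun.diff_left)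
      also have "\<dots> \<le> norm (g - f) * 1"
        using that by (intro mult_left_mono) auto
      finally show ?thesis using \<open>dist g f < \<delta> / 4\<close> by (simp add: dist_norm)
    qed
    fix z assume z: "z \<in> cball 0 1" "\<phi> x + blinfun_apply g x - \<delta> / 2 < \<phi> z + blinfun_apply g z"
    have "\<phi> x + blinfun_apply f x - \<delta> < \<phi> z + blinfun_apply f z"
      using diff[OF x(1)] diff[OF z(1)] z(2) unfolding abs_le_iff by linarith
    with z(1) show "norm (z - x) < \<epsilon>" by (rule slice)
  qed
  then show "\<exists>e>0. \<forall>g. dist g f < e \<longrightarrow> g \<in> {f. small_slice \<phi> \<epsilon> f}"
    using x(2) by (intro exI[of _ "\<delta> / 4"]) simp
qed

text \<open>
  The centres of slices of radius \<open>1 / (k + 1)\<close> form a Cauchy sequence, because of two such centres the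
  one with the larger value lies in the slice of the other. The limit is the strong maximum.
\<close>

lemma small_slices_imp_strong_maximum:
  fixes \<phi> :: "'a::banach \<Rightarrow> real"
  assumes cont: "continuous_on (cball 0 1) \<phi>"
    and small: "\<And>k :: nat. small_slice \<phi> (1 / real (Suc k)) f"
  shows "\<exists>x\<in>cball 0 1. (\<forall>z\<in>cball 0 1. \<phi> z + blinfun_apply f z \<le> \<phi> x + blinfun_apply f x) \<and>
    (\<forall>\<epsilon>>0. \<exists>\<delta>>0. \<forall>z\<in>cball 0 1.
      \<phi> x + blinfun_apply f x - \<delta> < \<phi> z + blinfun_apply f z \<longrightarrow> norm (z - x) < \<epsilon>)"
proof -
  define h where "h z = \<phi> z + blinfun_apply f z" for z
  have cont_h: "continuous_on (cball 0 1) h"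
    unfolding h_def by (intro continuous_intros cont)
  have "\<forall>k. \<exists>p. fst p \<in> cball 0 1 \<and> 0 < snd p \<and>
      (\<forall>z\<in>cball 0 1. h (fst p) - snd p < h z \<longrightarrow> norm (z - fst p) < 1 / real (Suc k))"
    using small unfolding small_slice_def h_def by force
  from choice[OF this] obtain p where p: "\<And>k. fst (p k) \<in> cball 0 1 \<and> 0 < snd (p k) \<and>
      (\<forall>z\<in>cball 0 1. h (fst (p k)) - snd (p k) < h z \<longrightarrow> norm (z - fst (p k)) < 1 / real (Suc k))"
    by blast
  define x \<delta> where "x k = fst (p k)" and "\<delta> k = snd (p k)" for k
  have x: "x k \<in> cball 0 1" "0 < \<delta> k"
    and slice: "z \<in> cball 0 1 \<Longrightarrow> h (x k) - \<delta> k < h z \<Longrightarrow> norm (z - x k) < 1 / real (Suc k)" for k z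
    using p[of k] by (auto simp: x_def \<delta>_def)
  have close: "norm (x j - x k) < 1 / real (Suc M)" if "M \<le> j" "M \<le> k" for j k M
  proof (cases "h (x k) \<le> h (x j)")
    case True
    then have "norm (x j - x k) < 1 / real (Suc k)"
      using x(1)[of j] x(2)[of k] by (intro slice) simp_all
    also have "\<dots> \<le> 1 / real (Suc M)" using that by (simp add: frac_le)
    finally show ?thesis .
  next
    case False
    then have "norm (x k - x j) < 1 / real (Suc j)"
      using x(1)[of k] x(2)[of j] by (intro slice) simp_all
    also have "\<dots> \<le> 1 / real (Suc M)" using that by (simp add: frac_le)
    finally show ?thesis by (simp add: norm_minus_commute)
  qed
  have "Cauchy x"
  proof (rule CauchyI)
    fix e :: real assume "0 < e"
    then obtain M where "1 / real (Suc M) < e"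
      using nat_approx_posE by blast
    then show "\<exists>M. \<forall>m\<ge>M. \<forall>n\<ge>M. norm (x m - x n) < e"
      using close[of M] by (intro exI[of _ M]) (meson less_trans)
  qed
  then obtain a where lim: "x \<longlonglongrightarrow> a"
    using Cauchy_convergent convergent_def by blast
  have a: "a \<in> cball 0 1"
    using closed_sequentially[OF closed_cball _ lim] x by blast
  have close_a: "norm (a - x k) \<le> 1 / real (Suc k)" for k
  proof (rule LIMSEQ_le_const2[OF tendsto_norm[OF tendsto_diff[OF lim tendsto_const]]])
    show "\<exists>M. \<forall>n\<ge>M. norm (x n - x k) \<le> 1 / real (Suc k)"
      using close[of k _ k] by (intro exI[of _ k]) (auto intro: less_imp_le)
  qed
  have lim_h: "(\<lambda>k. h (x k)) \<longlonglongrightarrow> h a"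
    using cont_h a x lim by (auto simp: continuous_on_sequentially o_def)
  have max: "h z \<le> h a" if z: "z \<in> cball 0 1" for z
  proof (rule ccontr)
    assume "\<not> h z \<le> h a"
    then have "\<forall>\<^sub>F k in sequentially. h (x k) < h z"
      using lim_h by (intro order_tendstoD(2)) auto
    then have "\<forall>\<^sub>F k in sequentially. norm (z - x k) \<le> 1 / real (Suc k)"
    proof eventually_elim
      case (elim k)
      then have "h (x k) - \<delta> k < h z" using x(2)[of k] by simp
      then show ?case using slice[OF z] by (simp add: less_imp_le)
    qed
    then have "(\<lambda>k. z - x k) \<longlonglongrightarrow> 0"
      by (rule Lim_null_comparison) (rule LIMSEQ_Suc[OF lim_1_over_n])
    moreover have "(\<lambda>k. z - x k) \<longlonglongrightarrow> z - a"
      by (intro tendsto_intros lim)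
    ultimately have "z = a" using LIMSEQ_unique by fastforce
    with \<open>\<not> h z \<le> h a\<close> show False by simp
  qed
  have "\<exists>\<delta>>0. \<forall>z\<in>cball 0 1. h a - \<delta> < h z \<longrightarrow> norm (z - a) < \<epsilon>" if "0 < \<epsilon>" for \<epsilon>
  proof -
    have "0 < \<epsilon> / 2" using that by simp
    then obtain k where k: "1 / real (Suc k) < \<epsilon> / 2"
      by (rule nat_approx_posE)
    have "norm (z - a) < \<epsilon>" if z: "z \<in> cball 0 1" "h a - \<delta> k < h z" for z
    proof -
      have "h (x k) - \<delta> k < h z" using max[OF x(1)[of k]] z(2) by simp
      then have "norm (z - x k) < 1 / real (Suc k)" using z(1) by (intro slice)
      moreover have "norm (z - a) \<le> norm (z - x k) + norm (a - x k)"
        by (metis norm_diff_triangle_le norm_minus_commute order_refl)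
      ultimately show ?thesis using close_a[of k] k by linarith
    qed
    with x(2) show ?thesis by blast
  qed
  with a max show ?thesis unfolding h_def by blast
qed

lemma baire_dense_Inter:
  fixes U :: "nat \<Rightarrow> 'a::{complete_space} set"
  assumes "\<And>k. open (U k)" and "\<And>k. closure (U k) = UNIV"
  shows "closure (\<Inter>k. U k) = UNIV"
proof -
  have "Met_TC.mtopology closure_of \<Inter>(range U) = (UNIV :: 'a set)"
  proof (rule Met_TC.metric_Baire_category)
    show "Met_TC.mcomplete TYPE('a)"
      by (simp add: complete_UNIV)
    show "countable (range U)" by simp
  qed (use assms in auto)
  then show ?thesis by simp
qed

text \<open>
  Stegall's variational principle for continuous functions on the unit ball that are bounded above.
\<close>

theorem exists_strong_maximum:
  fixes \<phi> :: "'a::banach \<Rightarrow> real"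
  assumes rnp: "radon_nikodym_property TYPE('a)"
    and cont: "continuous_on (cball 0 1) \<phi>"
    and bdd: "\<And>z. z \<in> cball 0 1 \<Longrightarrow> \<phi> z \<le> C" and \<eta>: "0 < \<eta>"
  shows "\<exists>f :: 'a \<Rightarrow>\<^sub>L real. norm f < \<eta> \<and>
    (\<exists>x\<in>cball 0 1. (\<forall>z\<in>cball 0 1. \<phi> z + blinfun_apply f z \<le> \<phi> x + blinfun_apply f x) \<and>
      (\<forall>\<epsilon>>0. \<exists>\<delta>>0. \<forall>z\<in>cball 0 1.
        \<phi> x + blinfun_apply f x - \<delta> < \<phi> z + blinfun_apply f z \<longrightarrow> norm (z - x) < \<epsilon>))"
proof -
  define U where "U k = {f. small_slice \<phi> (1 / real (Suc k)) f}" for k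
  have dense: "closure (U k) = UNIV" for k
  proof -
    have "\<exists>g\<in>U k. dist g f < e" if "0 < e" for f e
    proof -
      have "\<phi> z + blinfun_apply f z \<le> C + norm f" if z: "z \<in> cball 0 1" for z
      proof -
        have "blinfun_apply f z \<le> norm f * norm z"
          using norm_blinfun[of f z] by simp
        also have "\<dots> \<le> norm f * 1" using z by (intro mult_left_mono) auto
        finally show ?thesis using bdd[OF z] by simp
      qed
      then obtain g where g: "norm g \<le> e / 2" and slice: "small_slice (\<lambda>z. \<phi> z + blinfun_apply f z) (1 / real (Suc k)) g"
        unfolding small_slice_def
        using exists_small_slice[OF rnp, of "\<lambda>z. \<phi> z + blinfun_apply f z" "C + norm f" "e / 2" "1 / real (Suc k)"] \<open>0 < e\<close>
        by (auto simp del: of_nat_Suc)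
      have "f + g \<in> U k"
        using slice unfolding U_def small_slice_def by (simp add: blinfun.add_left add.assoc)
      moreover have "dist (f + g) f < e" using g \<open>0 < e\<close> by (simp add: dist_norm)
      ultimately show ?thesis by blast
    qed
    then show ?thesis by (auto simp: closure_approachable)
  qed
  have "closure (\<Inter>k. U k) = UNIV"
    using dense by (intro baire_dense_Inter) (simp add: U_def open_small_slice)
  then have "0 \<in> closure (\<Inter>k. U k)" by simp
  then obtain f where f: "f \<in> (\<Inter>k. U k)" "dist f 0 < \<eta>"
    using \<eta> unfolding closure_approachable by blast
  then have "small_slice \<phi> (1 / real (Suc k)) f" for k
    by (auto simp: U_def simp del: of_nat_Suc)
  from small_slices_imp_strong_maximum[OF cont this] f(2) show ?thesis
    by (intro exI[of _ f]) simp
qed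


section \<open>Strongly exposing operators and the Bhatia-Semrl property\<close>

lemma blinfun_norm_le:
  fixes F :: "'a::real_normed_vector \<Rightarrow>\<^sub>L 'b::real_normed_vector"
  assumes le: "\<And>z. z \<in> cball 0 1 \<Longrightarrow> norm (blinfun_apply F z) \<le> m"
  shows "norm F \<le> m"
proof (rule norm_blinfun_bound)
  show "0 \<le> m" using le[of 0] by simp
  fix x
  show "norm (blinfun_apply F x) \<le> m * norm x"
  proof (cases "x = 0")
    case False
    then show ?thesis
      using le[of "(1 / norm x) *\<^sub>R x"] by (simp add: blinfun.scaleR_right field_simps)
  qed simp
qed

lemma blinfun_norm_le_cball:
  fixes F :: "'a::real_normed_vector \<Rightarrow>\<^sub>L 'b::real_normed_vector"
  assumes "z \<in> cball 0 1"
  shows "norm (blinfun_apply F z) \<le> norm F"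
proof -
  have "norm (blinfun_apply F z) \<le> norm F * norm z" by (rule norm_blinfun)
  also have "\<dots> \<le> norm F * 1" using assms by (intro mult_left_mono) auto
  finally show ?thesis by simp
qed

lemma bounded_ops_add:
  assumes "banach_over sY" "S \<in> bounded_ops sX sY" "T \<in> bounded_ops sX sY"
  shows "S + T \<in> bounded_ops sX sY"
proof -
  interpret banach_over sY by fact
  show ?thesis using assms(2,3) by (simp add: bounded_ops_def blinfun.add_left scale_right_distrib)
qed

lemma bounded_ops_op_scale:
  assumes "banach_over sY" "A \<in> bounded_ops sX sY"
  shows "op_scale sY c A \<in> bounded_ops sX sY"
proof -
  interpret banach_over sY by fact
  show ?thesis using assms(2)
    by (simp add: bounded_ops_def op_scale_apply[OF assms(1)] mult.commute)
qed

text \<open>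
  The operator \<open>S\<close> attains its norm strongly at \<open>x0\<close>, up to scalars of modulus one. Orthogonality of \<open>S\<close>
  to \<open>A\<close> is then witnessed at \<open>x0\<close>.
\<close>

theorem strongly_exposing_bhatia_semrl:
  fixes sX :: "'k::real_or_complex \<Rightarrow> 'x::banach \<Rightarrow> 'x" and sY :: "'k \<Rightarrow> 'y::banach \<Rightarrow> 'y"
  assumes X: "banach_over sX" and Y: "banach_over sY" and S: "S \<in> bounded_ops sX sY"
    and x0: "x0 \<in> norm_attainment_set S"
    and exposing: "\<And>\<epsilon>. 0 < \<epsilon> \<Longrightarrow> \<exists>\<delta>>0. \<forall>z\<in>cball 0 1.
      norm S - \<delta> < norm (blinfun_apply S z) \<longrightarrow> (\<exists>c. norm c = 1 \<and> norm (sX c z - x0) < \<epsilon>)"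
  shows "bhatia_semrl sX sY S"
  unfolding bhatia_semrl_def
proof (intro ballI iffI)
  interpret Y: banach_over sY by (rule Y)
  fix A assume A: "A \<in> bounded_ops sX sY"
    and orth: "bj_orthogonal (op_scale sY) S A"
  have "bj_orthogonal sY (blinfun_apply S x0) (blinfun_apply A x0)"
    unfolding bj_orthogonal_def
  proof
    fix c
    define B where "B = op_scale sY c A"
    have B: "B \<in> bounded_ops sX sY" unfolding B_def by (intro bounded_ops_op_scale Y A)
    then have SB: "S + B \<in> bounded_ops sX sY" by (intro bounded_ops_add Y S)
    have norm_SB: "norm S \<le> norm (S + t *\<^sub>R B)" for t
    proof -
      have "op_scale sY (of_real t * c) A = t *\<^sub>R B"
        by (rule blinfun_eqI)
          (simp add: B_def op_scale_apply[OF Y] blinfun.scaleR_left Y.scale_of_real flip: Y.scale_scale)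
      then show ?thesis using orth unfolding bj_orthogonal_def by metis
    qed
    have approx: "norm S - \<epsilon> * (1 + norm (S + B)) \<le> norm (blinfun_apply (S + B) x0)" if "0 < \<epsilon>" for \<epsilon>
    proof -
      obtain \<delta> where \<delta>: "0 < \<delta>" "\<And>z. z \<in> cball 0 1 \<Longrightarrow>
          norm S - \<delta> < norm (blinfun_apply S z) \<Longrightarrow> \<exists>a. norm a = 1 \<and> norm (sX a z - x0) < \<epsilon>"
        using exposing[OF \<open>0 < \<epsilon>\<close>] by blast
      \<comment> \<open>The last bound makes vectors that norm \<open>S + t B\<close> up to \<open>t * t\<close> norm \<open>S\<close> up to \<open>\<delta>\<close>.\<close>
      \<comment> \<open>The error \<open>t * t\<close> still tends to 0 after the division by \<open>t\<close> in the convexity argument.\<close>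
      define t where "t = min (min 1 \<epsilon>) (\<delta> / (1 + norm B))"
      have B_pos: "0 < 1 + norm B" by (simp add: add_pos_nonneg)
      have "t \<le> \<delta> / (1 + norm B)" by (simp add: t_def)
      then have t: "0 < t" "t \<le> 1" "t \<le> \<epsilon>" "t * (1 + norm B) \<le> \<delta>"
        using \<open>0 < \<epsilon>\<close> \<delta>(1) B_pos by (simp_all only: pos_le_divide_eq) (auto simp: t_def)
      have "\<exists>z\<in>cball 0 1. norm (S + t *\<^sub>R B) - t * t < norm (blinfun_apply (S + t *\<^sub>R B) z)"
      proof (rule ccontr)
        assume "\<not> ?thesis"
        then have "norm (S + t *\<^sub>R B) \<le> norm (S + t *\<^sub>R B) - t * t"
          by (intro blinfun_norm_le) (auto simp: not_less)
        then show False using mult_pos_pos[OF t(1) t(1)] by simp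
      qed
      then obtain z where z: "z \<in> cball 0 1"
        and "norm (S + t *\<^sub>R B) - t * t < norm (blinfun_apply (S + t *\<^sub>R B) z)" by blast
      then have attain: "norm S - t * t < norm (blinfun_apply S z + t *\<^sub>R blinfun_apply B z)"
        using norm_SB[of t] by (simp add: blinfun.add_left blinfun.scaleR_left)
      have "norm (blinfun_apply S z + t *\<^sub>R blinfun_apply B z) \<le> norm (blinfun_apply S z) + t * norm (blinfun_apply B z)"
        using norm_triangle_ineq[of "blinfun_apply S z" "t *\<^sub>R blinfun_apply B z"] t(1) by simp
      also have "t * norm (blinfun_apply B z) \<le> t * norm B"
        using blinfun_norm_le_cball[OF z, of B] t(1) by simp
      finally have "norm S - t * t - t * norm B < norm (blinfun_apply S z)"
        using attain by simp
      moreover have "t * t + t * norm B \<le> \<delta>"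
      proof -
        have "t * t \<le> t * 1" using t(1,2) by (intro mult_left_mono) auto
        then show ?thesis using t(4) by (simp add: distrib_left)
      qed
      ultimately have "norm S - \<delta> < norm (blinfun_apply S z)" by linarith
      from \<delta>(2)[OF z this] obtain a where a: "norm a = 1" "norm (sX a z - x0) < \<epsilon>" by blast
      \<comment> \<open>Convexity: the value at \<open>t\<close> is bounded by those at 0 and 1.\<close>
      have "blinfun_apply S z + t *\<^sub>R blinfun_apply B z = (1 - t) *\<^sub>R blinfun_apply S z + t *\<^sub>R blinfun_apply (S + B) z"
        by (simp add: blinfun.add_left algebra_simps)
      then have "norm (blinfun_apply S z + t *\<^sub>R blinfun_apply B z) \<le>
          norm ((1 - t) *\<^sub>R blinfun_apply S z) + norm (t *\<^sub>R blinfun_apply (S + B) z)"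
        by (metis norm_triangle_ineq)
      also have "\<dots> = (1 - t) * norm (blinfun_apply S z) + t * norm (blinfun_apply (S + B) z)"
        using t(1,2) by simp
      also have "(1 - t) * norm (blinfun_apply S z) \<le> (1 - t) * norm S"
        using blinfun_norm_le_cball[OF z, of S] t(2) by (intro mult_left_mono) auto
      finally have "t * (norm S - t) < t * norm (blinfun_apply (S + B) z)"
        using attain by (simp add: algebra_simps)
      then have "norm S - t < norm (blinfun_apply (S + B) z)"
        using t(1) by simp
      also have "norm (blinfun_apply (S + B) z) = norm (blinfun_apply (S + B) (sX a z))"
        using SB a(1) by (simp add: bounded_ops_def Y.norm_scale)
      also have "\<dots> \<le> norm (blinfun_apply (S + B) x0) + norm (blinfun_apply (S + B) (sX a z - x0))"
        using norm_triangle_ineq[of "blinfun_apply (S + B) x0" "blinfun_apply (S + B) (sX a z - x0)"]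
        by (simp add: blinfun.diff_right)
      also have "norm (blinfun_apply (S + B) (sX a z - x0)) \<le> norm (S + B) * \<epsilon>"
        using norm_blinfun[of "S + B" "sX a z - x0"] a(2)
        by (meson less_imp_le mult_left_mono norm_ge_zero order_trans)
      finally show ?thesis using t(3) by (simp add: distrib_left mult.commute)
    qed
    have "norm S \<le> norm (blinfun_apply (S + B) x0)"
    proof (rule field_le_epsilon)
      fix e :: real assume "0 < e"
      have pos: "0 < 1 + norm (S + B)" by (simp add: add_pos_nonneg)
      then have "0 < e / (1 + norm (S + B))" using \<open>0 < e\<close> by simp
      from approx[OF this] pos show "norm S \<le> norm (blinfun_apply (S + B) x0) + e" by simp
    qed
    then show "norm (blinfun_apply S x0) \<le> norm (blinfun_apply S x0 + sY c (blinfun_apply A x0))"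
      using x0 by (simp add: norm_attainment_set_def B_def blinfun.add_left op_scale_apply[OF Y])
  qed
  with x0 show "\<exists>x\<in>norm_attainment_set S. bj_orthogonal sY (blinfun_apply S x) (blinfun_apply A x)"
    by blast
next
  fix A assume "\<exists>x\<in>norm_attainment_set S. bj_orthogonal sY (blinfun_apply S x) (blinfun_apply A x)"
  then obtain x where x: "norm x = 1" "norm (blinfun_apply S x) = norm S"
    and orth: "\<And>c. norm (blinfun_apply S x) \<le> norm (blinfun_apply S x + sY c (blinfun_apply A x))"
    unfolding norm_attainment_set_def bj_orthogonal_def by auto
  show "bj_orthogonal (op_scale sY) S A"
    unfolding bj_orthogonal_def
  proof
    fix c
    have "norm S \<le> norm (blinfun_apply (S + op_scale sY c A) x)"
      using orth[of c] x(2) by (simp add: blinfun.add_left op_scale_apply[OF Y])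
    also have "\<dots> \<le> norm (S + op_scale sY c A)"
      using x(1) by (intro blinfun_norm_le_cball) simp
    finally show "norm S \<le> norm (S + op_scale sY c A)" .
  qed
qed

text \<open>
  Every real functional \<open>f\<close> is the real part of a scalar functional \<open>g\<close>: \<open>g = f\<close> over the reals, and
  \<open>g x = f x - i * f (i x)\<close> over the complex numbers. The last two properties express what is needed of
  the real part without mentioning it. The factor 2 in the norm bound is not sharp.
\<close>

lemma (in banach_over) exists_scalar_functional:
  fixes f :: "'x \<Rightarrow>\<^sub>L real"
  shows "\<exists>g :: 'x \<Rightarrow> 'k. bounded_linear g \<and> (\<forall>c x. g (scale c x) = c * g x) \<and>
    (\<forall>x. norm (g x) \<le> 2 * norm f * norm x) \<and> (\<forall>x. blinfun_apply f x \<le> norm (g x)) \<and>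
    (\<forall>x r. g x = of_real r \<longrightarrow> blinfun_apply f x = r)"
proof -
  obtain F :: "'k \<Rightarrow> complex" where add: "\<And>x y. F (x + y) = F x + F y"
    and mult: "\<And>x y. F (x * y) = F x * F y" and scaleR: "\<And>r x. F (r *\<^sub>R x) = r *\<^sub>R F x"
    and norm: "\<And>x. cmod (F x) = norm x" and range: "range F = \<real> \<or> range F = UNIV"
    using real_or_complex by blast
  have F0: "F 0 = 0" using norm[of 0] by simp
  have diff: "F (x - y) = F x - F y" for x y
    using add[of "x - y" y] by simp
  have inj: "x = y" if "F x = F y" for x y
    using norm[of "x - y"] that by (simp add: diff)
  have F1: "F 1 = 1"
  proof -
    have "F 1 * F 1 = F 1 * 1" using mult[of 1 1] by simp
    moreover have "F 1 \<noteq> 0" using norm[of 1] by auto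
    ultimately show ?thesis by simp
  qed
  have real: "F (of_real r) = complex_of_real r" for r
    using scaleR[of r 1] by (simp add: F1 scaleR_conv_of_real)
  have fscale: "blinfun_apply f (r *\<^sub>R x) = r * blinfun_apply f x" for r x
    by (simp add: blinfun.scaleR_right)
  have fnorm: "\<bar>blinfun_apply f x\<bar> \<le> norm f * norm x" for x
    using norm_blinfun[of f x] by simp
  from range show ?thesis
  proof
    assume range: "range F = \<real>"
    let ?g = "\<lambda>x. of_real (blinfun_apply f x) :: 'k"
    have "?g (scale c x) = c * ?g x" for c x
    proof -
      have "F c \<in> \<real>" using range by blast
      then obtain r where "F c = complex_of_real r" by (rule Reals_cases)
      then have c: "c = of_real r" by (intro inj) (simp add: real)
      show ?thesis unfolding c by (simp add: scale_of_real fscale)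
    qed
    moreover have "bounded_linear ?g"
      by (rule bounded_linear_compose[OF bounded_linear_of_real blinfun.bounded_linear_right])
    moreover have "norm (?g x) \<le> 2 * norm f * norm x" for x
      using fnorm[of x] mult_nonneg_nonneg[of "norm f" "norm x"] by simp
    ultimately show ?thesis
      by (intro exI[of _ ?g]) auto
  next
    assume range: "range F = UNIV"
    then obtain i where i: "F i = \<i>" by (metis UNIV_I rangeE)
    have ii: "i * i = - 1"
      by (rule inj) (simp add: mult i diff[of 0 1, simplified] F0 F1)
    have ni: "norm i = 1" using norm[of i] by (simp add: i)
    let ?g = "\<lambda>x. of_real (blinfun_apply f x) - i * of_real (blinfun_apply f (scale i x)) :: 'k"
    have "?g (scale c x) = c * ?g x" for c x
    proof -
      define a b where "a = Re (F c)" and "b = Im (F c)"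
      have c: "c = of_real a + i * of_real b"
        by (rule inj) (simp add: add mult real i a_def b_def complex_eq)
      have comm: "scale i (r *\<^sub>R y) = r *\<^sub>R scale i y" for r y
        by (metis scale_of_real scale_left_commute)
      have 1: "scale c x = a *\<^sub>R x + b *\<^sub>R scale i x"
        unfolding c by (simp add: scale_left_distrib scale_of_real comm flip: scale_scale)
      have "scale i (scale i x) = - x"
        using scale_of_real[of "-1" x] by (simp add: ii)
      then have 2: "scale i (scale c x) = a *\<^sub>R scale i x - b *\<^sub>R x"
        unfolding 1 by (simp add: scale_right_distrib comm)
      have 3: "blinfun_apply f (scale c x) = a * blinfun_apply f x + b * blinfun_apply f (scale i x)"
        unfolding 1 by (simp add: blinfun.add_right fscale)
      have 4: "blinfun_apply f (scale i (scale c x)) = a * blinfun_apply f (scale i x) - b * blinfun_apply f x"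
        unfolding 2 by (simp add: blinfun.diff_right fscale)
      have ii': "i * (i * y) = - y" for y
        using ii by (simp flip: mult.assoc)
      show ?thesis
        unfolding 3 4 unfolding c by (simp add: algebra_simps ii')
    qed
    moreover have "bounded_linear ?g"
    proof -
      have "bounded_linear (\<lambda>x. of_real (blinfun_apply f x) :: 'k)"
        by (rule bounded_linear_compose[OF bounded_linear_of_real blinfun.bounded_linear_right])
      from this bounded_linear_compose[OF this bounded_linear_scale[of i]] show ?thesis
        by (intro bounded_linear_sub bounded_linear_const_mult)
    qed
    moreover have "norm (?g x) \<le> 2 * norm f * norm x" for x
    proof -
      have "norm (?g x) \<le> norm (of_real (blinfun_apply f x) :: 'k) + norm (i * of_real (blinfun_apply f (scale i x)))"
        by (rule norm_triangle_ineq4)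
      also have "\<dots> = \<bar>blinfun_apply f x\<bar> + \<bar>blinfun_apply f (scale i x)\<bar>"
        by (simp add: norm_mult ni)
      also have "\<dots> \<le> norm f * norm x + norm f * norm x"
        using fnorm[of x] fnorm[of "scale i x"] by (intro add_mono) (simp_all add: norm_scale ni)
      finally show ?thesis by (simp add: algebra_simps)
    qed
    moreover have Re: "Re (F (?g x)) = blinfun_apply f x" for x
      by (simp add: diff mult real i)
    have "blinfun_apply f x \<le> norm (?g x)" for x
      using complex_Re_le_cmod[of "F (?g x)"] Re[of x] norm[of "?g x"] by simp
    moreover have "blinfun_apply f x = r" if "?g x = of_real r" for x r
      using Re[of x] that by (simp add: real)
    ultimately show ?thesis
      by (intro exI[of _ ?g]) blast
  qed
qed

text \<open>
  Every operator is close to one that attains its norm strongly, up to scalars of modulus one.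
\<close>

theorem exists_strongly_exposing_perturbation:
  fixes sX :: "'k::real_or_complex \<Rightarrow> 'x::banach \<Rightarrow> 'x" and sY :: "'k \<Rightarrow> 'y::banach \<Rightarrow> 'y"
  assumes X: "banach_over sX" and Y: "banach_over sY"
    and "\<exists>x::'x. x \<noteq> 0" and "\<exists>y::'y. y \<noteq> 0"
    and rnp: "radon_nikodym_property TYPE('x)"
    and T: "T \<in> bounded_ops sX sY" and "0 < e"
  shows "\<exists>S\<in>bounded_ops sX sY. dist S T < e \<and> (\<exists>x0\<in>norm_attainment_set S.
    \<forall>\<epsilon>>0. \<exists>\<delta>>0. \<forall>z\<in>cball 0 1. norm S - \<delta> < norm (blinfun_apply S z) \<longrightarrow>
      (\<exists>c. norm c = 1 \<and> norm (sX c z - x0) < \<epsilon>))"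
proof -
  interpret X: banach_over sX by (rule X)
  interpret Y: banach_over sY by (rule Y)
  define \<phi> where "\<phi> z = norm (blinfun_apply T z)" for z
  have "continuous_on (cball 0 1) \<phi>"
    unfolding \<phi>_def by (intro continuous_intros)
  moreover have "\<phi> z \<le> norm T" if "z \<in> cball 0 1" for z
    unfolding \<phi>_def using that by (rule blinfun_norm_le_cball)
  ultimately obtain f x0 where f: "norm f < e / 2" and x0: "x0 \<in> cball 0 1"
    and max: "\<And>z. z \<in> cball 0 1 \<Longrightarrow> \<phi> z + blinfun_apply f z \<le> \<phi> x0 + blinfun_apply f x0"
    and strong: "\<And>\<epsilon>. 0 < \<epsilon> \<Longrightarrow> \<exists>\<delta>>0. \<forall>z\<in>cball 0 1.
        \<phi> x0 + blinfun_apply f x0 - \<delta> < \<phi> z + blinfun_apply f z \<longrightarrow> norm (z - x0) < \<epsilon>"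
    using exists_strong_maximum[OF rnp, of \<phi> "norm T" "e / 2"] \<open>0 < e\<close> by auto
  define m where "m = \<phi> x0 + blinfun_apply f x0"
  have unique: "z = x0" if "z \<in> cball 0 1" "\<phi> z + blinfun_apply f z = m" for z
  proof (rule ccontr)
    assume "z \<noteq> x0"
    then have "0 < norm (z - x0)" by simp
    from strong[folded m_def, OF this] obtain \<delta> where \<delta>: "0 < \<delta>"
      "\<forall>y\<in>cball 0 1. m - \<delta> < \<phi> y + blinfun_apply f y \<longrightarrow> norm (y - x0) < norm (z - x0)"
      by (elim exE conjE) (rule that)
    from bspec[OF \<delta>(2) \<open>z \<in> cball 0 1\<close>] \<delta>(1) \<open>\<phi> z + blinfun_apply f z = m\<close> show False
      by simp
  qed
  obtain g :: "'x \<Rightarrow> 'k" where lin: "bounded_linear g" and g_scale: "\<And>c x. g (sX c x) = c * g x"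
    and g_norm: "\<And>x. norm (g x) \<le> 2 * norm f * norm x"
    and f_le: "\<And>x. blinfun_apply f x \<le> norm (g x)"
    and f_eq: "\<And>x r. g x = of_real r \<Longrightarrow> blinfun_apply f x = r"
    using X.exists_scalar_functional[of f] by blast
  have rotate: "\<exists>c. norm c = 1 \<and> g (sX c z) = of_real (norm (g z))" for z
  proof (cases "g z = 0")
    case True
    then show ?thesis by (intro exI[of _ 1]) (simp add: g_scale)
  next
    case False
    then show ?thesis
      by (intro exI[of _ "of_real (norm (g z)) / g z"]) (simp add: g_scale norm_divide)
  qed
  have rotated: "sX c z \<in> cball 0 1"
    "\<phi> (sX c z) + blinfun_apply f (sX c z) = \<phi> z + norm (g z)"
    if "z \<in> cball 0 1" "norm c = 1" "g (sX c z) = of_real (norm (g z))" for c z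
    using that T f_eq[OF that(3)] by (simp_all add: X.norm_scale \<phi>_def bounded_ops_def Y.norm_scale)
  have le_m: "\<phi> z + norm (g z) \<le> m" if "z \<in> cball 0 1" for z
  proof -
    obtain c where c: "norm c = 1" "g (sX c z) = of_real (norm (g z))"
      using rotate by blast
    from rotated[OF that c] max[of "sX c z"] show ?thesis by (simp add: m_def)
  qed
  \<comment> \<open>Rotating \<open>x0\<close> so that \<open>g\<close> becomes nonnegative does not decrease \<open>\<phi> + f\<close>, so by uniqueness \<open>g x0\<close> is already nonnegative.\<close>
  have gx0: "g x0 = of_real (norm (g x0))" and fx0: "blinfun_apply f x0 = norm (g x0)"
  proof -
    have eq: "\<phi> x0 + norm (g x0) = m"
      using le_m[OF x0] f_le[of x0] by (simp add: m_def)
    then show "blinfun_apply f x0 = norm (g x0)" by (simp add: m_def)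
    obtain c where c: "norm c = 1" "g (sX c x0) = of_real (norm (g x0))"
      using rotate by blast
    then have "sX c x0 = x0"
      using rotated[OF x0 c] eq by (intro unique) auto
    with c(2) show "g x0 = of_real (norm (g x0))" by simp
  qed
  obtain y0 :: 'y where y0: "norm y0 = 1" "blinfun_apply T x0 = \<phi> x0 *\<^sub>R y0"
  proof (cases "blinfun_apply T x0 = 0")
    case True
    obtain y :: 'y where "y \<noteq> 0" using assms(4) by blast
    with True show ?thesis
      by (intro that[of "(1 / norm y) *\<^sub>R y"]) (simp_all add: \<phi>_def)
  next
    case False
    then show ?thesis
      by (intro that[of "(1 / \<phi> x0) *\<^sub>R blinfun_apply T x0"]) (simp_all add: \<phi>_def)
  qed
  have R_lin: "bounded_linear (\<lambda>x. sY (g x) y0)"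
  proof (rule bounded_linear_intro)
    interpret g: bounded_linear g by (rule lin)
    show "sY (g (x + y)) y0 = sY (g x) y0 + sY (g y) y0" for x y
      by (simp add: g.add Y.scale_left_distrib)
    show "sY (g (r *\<^sub>R x)) y0 = r *\<^sub>R sY (g x) y0" for r x
      by (simp add: g.scaleR scaleR_conv_of_real flip: Y.scale_scale Y.scale_of_real)
    show "norm (sY (g x) y0) \<le> norm x * (2 * norm f)" for x
      using g_norm[of x] by (simp add: Y.norm_scale y0(1) mult.commute)
  qed
  define R where "R = Blinfun (\<lambda>x. sY (g x) y0)"
  have R: "blinfun_apply R x = sY (g x) y0" for x
    unfolding R_def by (simp add: bounded_linear_Blinfun_apply[OF R_lin])
  define S where "S = T + R"
  have S_apply: "blinfun_apply S x = blinfun_apply T x + sY (g x) y0" for x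
    by (simp add: S_def R blinfun.add_left)
  have "R \<in> bounded_ops sX sY"
    by (simp add: bounded_ops_def R g_scale)
  then have S: "S \<in> bounded_ops sX sY"
    unfolding S_def by (intro bounded_ops_add Y T)
  have "norm R \<le> 2 * norm f"
    using g_norm by (intro norm_blinfun_bound) (simp_all add: R Y.norm_scale y0(1))
  then have dist: "dist S T < e" using f by (simp add: dist_norm S_def)
  have S_le: "norm (blinfun_apply S z) \<le> \<phi> z + norm (g z)" for z
    using norm_triangle_ineq[of "blinfun_apply T z" "sY (g z) y0"]
    by (simp add: S_apply \<phi>_def Y.norm_scale y0(1))
  have "norm S \<le> m"
    by (intro blinfun_norm_le order_trans[OF S_le le_m])
  have "blinfun_apply S x0 = \<phi> x0 *\<^sub>R y0 + norm (g x0) *\<^sub>R y0"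
    unfolding S_apply y0(2) by (subst gx0) (simp only: Y.scale_of_real)
  also have "\<dots> = m *\<^sub>R y0"
    by (simp add: m_def fx0 scaleR_add_left)
  finally have Sx0: "norm (blinfun_apply S x0) = m"
    using y0(1) by (simp add: m_def fx0 \<phi>_def)
  with blinfun_norm_le_cball[OF x0, of S] \<open>norm S \<le> m\<close> have norm_S: "norm S = m" by simp
  have "norm x0 = 1"
  proof -
    have "m \<noteq> 0"
    proof
      \<comment> \<open>Then \<open>\<phi> + f\<close> vanishes on the whole ball, and the maximum is not strict.\<close>
      assume "m = 0"
      have zero: "z = x0" if z: "z \<in> cball 0 1" for z
      proof -
        have nonneg: "0 \<le> \<phi> z" by (simp add: \<phi>_def)
        have "norm (g z) \<le> 0" using le_m[OF z] nonneg \<open>m = 0\<close> by linarith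
        then have "g z = 0" by simp
        then have "blinfun_apply f z = 0" "\<phi> z = 0"
          using f_eq[of z 0] le_m[OF z] nonneg \<open>m = 0\<close> by simp_all
        then show ?thesis using z \<open>m = 0\<close> by (intro unique) simp_all
      qed
      obtain u :: 'x where "u \<noteq> 0" using assms(3) by blast
      then have "(1 / norm u) *\<^sub>R u = 0"
        using zero[of 0] zero[of "(1 / norm u) *\<^sub>R u"] by simp
      with \<open>u \<noteq> 0\<close> show False by simp
    qed
    moreover have "0 \<le> m" using norm_S by (metis norm_ge_zero)
    moreover have "m \<le> m * norm x0"
      using norm_blinfun[of S x0] by (simp add: Sx0 norm_S)
    ultimately show ?thesis using x0 by simp
  qed
  then have "x0 \<in> norm_attainment_set S"
    by (simp add: norm_attainment_set_def Sx0 norm_S)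
  moreover have "\<exists>\<delta>>0. \<forall>z\<in>cball 0 1. norm S - \<delta> < norm (blinfun_apply S z) \<longrightarrow>
      (\<exists>c. norm c = 1 \<and> norm (sX c z - x0) < \<epsilon>)" if \<epsilon>: "0 < \<epsilon>" for \<epsilon>
  proof -
    obtain \<delta> where \<delta>: "0 < \<delta>" "\<And>z. z \<in> cball 0 1 \<Longrightarrow> m - \<delta> < \<phi> z + blinfun_apply f z \<Longrightarrow> norm (z - x0) < \<epsilon>"
      using strong[OF \<epsilon>] unfolding m_def by blast
    have "\<exists>c. norm c = 1 \<and> norm (sX c z - x0) < \<epsilon>"
      if z: "z \<in> cball 0 1" "norm S - \<delta> < norm (blinfun_apply S z)" for z
    proof -
      obtain c where c: "norm c = 1" "g (sX c z) = of_real (norm (g z))"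
        using rotate by blast
      have "m - \<delta> < \<phi> (sX c z) + blinfun_apply f (sX c z)"
        using rotated(2)[OF z(1) c] z(2) S_le[of z] norm_S by simp
      with \<delta>(2)[OF rotated(1)[OF z(1) c]] c(1) show ?thesis by blast
    qed
    with \<delta>(1) show ?thesis by blast
  qed
  ultimately show ?thesis using S dist by blast
qed

section \<open>Density of the norm attaining operators with the Bhatia-Semrl property\<close>

theorem corollary3p39:
  fixes sX :: "'k::real_or_complex \<Rightarrow> 'x::banach \<Rightarrow> 'x"
    and sY :: "'k \<Rightarrow> 'y::banach \<Rightarrow> 'y"
  assumes "banach_over sX" and "banach_over sY"
    and "\<exists>x::'x. x \<noteq> 0"
    and "radon_nikodym_property TYPE('x)"
  shows "bounded_ops sX sY
    \<subseteq> closure {T \<in> bounded_ops sX sY. norm_attaining T \<and> bhatia_semrl sX sY T}"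
proof
  fix T assume T: "T \<in> bounded_ops sX sY"
  show "T \<in> closure {T \<in> bounded_ops sX sY. norm_attaining T \<and> bhatia_semrl sX sY T}"
  proof (cases "\<exists>y::'y. y \<noteq> 0")
    case True
    show ?thesis
      unfolding closure_approachable
    proof (intro allI impI)
      fix e :: real assume "0 < e"
      from exists_strongly_exposing_perturbation[OF assms(1,2,3) True assms(4) T this]
      obtain S x0 where S: "S \<in> bounded_ops sX sY" "dist S T < e" "x0 \<in> norm_attainment_set S"
        and exposing: "\<And>\<epsilon>. 0 < \<epsilon> \<Longrightarrow> \<exists>\<delta>>0. \<forall>z\<in>cball 0 1. norm S - \<delta> < norm (blinfun_apply S z) \<longrightarrow>
          (\<exists>c. norm c = 1 \<and> norm (sX c z - x0) < \<epsilon>)" by blast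
      have "bhatia_semrl sX sY S"
        by (rule strongly_exposing_bhatia_semrl[OF assms(1,2) S(1,3) exposing])
      moreover have "norm_attaining S" using S(3) by (auto simp: norm_attaining_def)
      ultimately show "\<exists>S\<in>{T \<in> bounded_ops sX sY. norm_attaining T \<and> bhatia_semrl sX sY T}. dist S T < e"
        using S(1,2) by blast
    qed
  next
    case False
    \<comment> \<open>The range is the zero space, and every operator qualifies because the domain has unit vectors.\<close>
    then have norm_y: "norm y = 0" for y :: 'y by simp
    have norm_S: "norm S = 0" for S :: "'x \<Rightarrow>\<^sub>L 'y"
      using norm_blinfun_bound[of 0 S] by (simp add: norm_y)
    obtain u :: 'x where "u \<noteq> 0" using assms(3) by blast
    then have attain: "(1 / norm u) *\<^sub>R u \<in> norm_attainment_set T"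
      unfolding norm_attainment_set_def norm_y norm_S by simp
    moreover have "bhatia_semrl sX sY T"
      unfolding bhatia_semrl_def bj_orthogonal_def norm_y norm_S using attain by auto
    ultimately have "T \<in> {T \<in> bounded_ops sX sY. norm_attaining T \<and> bhatia_semrl sX sY T}"
      using T by (auto simp: norm_attaining_def)
    then show ?thesis by (rule subsetD[OF closure_subset])
  qed
qed

end
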